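(* Assume that for some constants $\gamma\ge 0$ and $\omega'\in[0,\hat\omega)$ one has $$\hat M b e^{\hat\omega\tau}\int_0^t|\alpha(s+\tau)|\,ds\le \gamma+\omega' t\qquad\text{for all } t>0,$$ and that $\int_{t-\tau}^t|\alpha(s)|\,ds\le\sigma$ for all $t\ge 0$, for some $\sigma>0$. Then there exist $\rho>0$ and $C_\rho>0$ with $$L(C_\rho)<\frac{\hat\omega-\omega'}{\hat M(1+e^{\hat\omega\tau})}$$ such that, if $\hat\Phi=(f_0,g_0,\eta^0)\in C([-\tau,0];\hat{\mathcal H})$, with $u_0:=f_0(0)$, $u_1:=g_0(0)$, satisfies $$\|u_1\|^2+(1-\tilde k)\|\sqrt A u_0\|^2+\int_{-\tau}^0\|\nabla\psi_2(f_0(s))\|^2ds+\int_0^{+\infty}k(s)\|\sqrt A\eta^0(s)\|^2ds+\int_{-\tau}^0|\alpha(s+\tau)|\,\|B^*g_0(s)\|^2ds<\rho^2$$ and $$\max_{s\in[-\tau,0]}\|\hat\Phi(s)\|_{\hat{\mathcal H}}<\rho,$$ then the abstract problem $U_t(t)=\hat{\mathscr A}U(t)+\alpha(t)\hat{\mathscr B}U(t-\tau)+\hat F(U(t),U(t-\tau))$, $t>0$, $U=\hat\Phi$ on $[-\tau,0]$, has a unique global solution, and this solution satisfies $\|U(t)\|_{\hat{\mathcal H}}\le C_\rho$ for all $t\ge0$.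
   Context: Setting. $H$ is a real Hilbert space with inner product $\langle\cdot,\cdot\rangle$ and norm $\|\cdot\|$; $A:D(A)\to H$ is a positive self-adjoint linear operator with dense domain $D(A)\subset H$; $\tau>0$ is a delay; $B:H\to H$ is a bounded linear operator with adjoint $B^*$; $\alpha\in L^1_{loc}([0,+\infty))$ satisfies $\int_{t-\tau}^t|\alpha(s)|ds\le\sigma$ for all $t\ge0$ and some $\sigma>0$ ($\alpha$ being understood as $0$ on negative times). The memory kernel $k:[0,+\infty)\to[0,+\infty)$ satisfies $k\in C^1(\mathbb R_+)\cap L^1(\mathbb R_+)$, $k(0)=k_0>0$, $\int_0^\infty k(t)dt=:\tilde k<1$, and $k'(t)\le-\zeta k(t)$ for some $\zeta>0$. Nonlinearities. $\psi_1,\psi_2:D(\sqrt A)\to\mathbb R$ are functionals with Gateaux derivatives $D\psi_i(u)$, such that: - for every $u\in D(\sqrt A)$ there is $c(u)>0$ with $|D\psi_i(u)(v)|\le c(u)\|v\|$ for all $v\in D(\sqrt A)$, $i=1,2$; then $D\psi_i(u)$ extends to $H$ and $\nabla\psi_i(u)\in H$ denotes its Riesz representative, $\langle\nabla\psi_i(u),v\rangle=D\psi_i(u)(v)$; - for all $R>0$ there is $L(R)>0$ with $\|\nabla\psi_i(u)-\nabla\psi_i(v)\|\le L(R)\|\sqrt A(u-v)\|$ whenever $u,v\in D(\sqrt A)$, $\|\sqrt A u\|\le R$, $\|\sqrt A v\|\le R$, $i=1,2$, and $L(R)\to0$ as $R\to0$; - $\psi_i(0)=0$, $\nabla\psi_i(0)=0$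 for $i=1,2$, and there is a strictly increasing continuous function $h_1:[0,\infty)\to\mathbb R$ with $|\langle\nabla\psi_1(u),u\rangle|\le h_1(\|\sqrt A u\|)\|\sqrt A u\|^2$ for all $u\in D(\sqrt A)$. The problem. The model is $u_{tt}(t)+Au(t)-\int_0^{+\infty}k(s)Au(t-s)ds+\alpha(t)BB^*u_t(t-\tau)=\nabla\psi_1(u(t))+\nabla\psi_2(u(t-\tau))$, $t>0$, with $u=f_0$ on $(-\infty,0]$ and $u_t=g_0$ on $[-\tau,0]$. With $\eta^t(s):=u(t)-u(t-s)$ for $s,t>0$, it becomes $u_{tt}+(1-\tilde k)Au+\int_0^{+\infty}k(s)A\eta^t(s)ds+\alpha(t)BB^*u_t(t-\tau)=\nabla\psi_1(u(t))+\nabla\psi_2(u(t-\tau))$, $\eta^t_t(s)=-\eta^t_s(s)+u_t(t)$, $\eta^0(s)=u_0-f_0(-s)$. Abstract form. $L^2_k((0,\infty);D(\sqrt A))$ is the Hilbert space of $D(\sqrt A)$-valued functions on $(0,\infty)$ with inner product $\int_0^\infty k(s)\langle\sqrt A\varphi_1(s),\sqrt A\varphi_2(s)\rangle ds$. $\hat{\mathcal H}=D(\sqrt A)\times H\times L^2_k((0,\infty);D(\sqrt A))$ has inner product $\langle(u,v,w),(\tilde u,\tilde v,\tilde w)\rangle_{\hat{\mathcal H}}=(1-\tilde k)\langle\sqrt A u,\sqrt A\tilde u\rangle+\langle v,\tilde v\rangle+\int_0^\infty k(s)\langle\sqrt A w(s),\sqrt A\tilde w(s)\rangle ds$. For $U=(u,v,w)$: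 $\hat{\mathscr A}U=(v,\,-(1-\tilde k)Au-\int_0^\infty k(s)Aw(s)ds,\,-w_s+v)$ with domain consisting of $(u,v,w)\in D(\sqrt A)\times D(\sqrt A)\times L^2_k((0,\infty);D(\sqrt A))$ with $(1-\tilde k)u+\int_0^\infty k(s)w(s)ds\in D(A)$, $w_s\in L^2_k((0,\infty);D(\sqrt A))$ and $w(0)=0$; $\hat{\mathscr B}U=(0,-BB^*v,0)$; $\hat F(U(t),U(t-\tau))=(0,\nabla\psi_1(u(t))+\nabla\psi_2(u(t-\tau)),0)$; $b=\|\hat{\mathscr B}\|=\|BB^*\|$; $\hat\Phi(s)=(f_0(s),g_0(s),\eta^0)$ for $s\in[-\tau,0]$. The operator $\hat{\mathscr A}$ generates an exponentially stable $C_0$-semigroup $(\hat S(t))_{t\ge0}$ on $\hat{\mathcal H}$; $\hat M,\hat\omega>0$ are fixed constants with $\|\hat S(t)\|\le\hat Me^{-\hat\omega t}$ for all $t\ge0$. The map $\hat F$ satisfies $\hat F(0,0)=0$ and $\|\hat F(U_1,U_1^\tau)-\hat F(U_2,U_2^\tau)\|_{\hat{\mathcal H}}\le L(R)(\|U_1-U_2\|_{\hat{\mathcal H}}+\|U_1^\tau-U_2^\tau\|_{\hat{\mathcal H}})$ when all four arguments have norm at most $R$; $L(\cdot)$ denotes one fixed function for which both this and the local Lipschitz property of the $\nabla\psi_i$ above hold, with $L(R)\to0$ as $R\to0$. A solution is a continuous $\hat{\mathcal H}$-valued function with $U=\hat\Phi$ on $[-\tau,0]$ and $U(t)=\hat S(t)U_0+\int_0^t\hat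 S(t-s)[\alpha(s)\hat{\mathscr B}U(s-\tau)+\hat F(U(s),U(s-\tau))]ds$ for $t\ge0$, $U_0=U(0)=\hat\Phi(0)$. *)

theory Defs
  imports "HOL-Analysis.Analysis"
begin

section \<open>Unbounded operators, given by a domain and a function used only on that domain\<close>

text \<open>The last clause says that the adjoint has the same graph as the operator itself:
  \<open>v\<close> lies in the domain of the adjoint with value \<open>w\<close> iff \<open>v\<close> lies in the domain of \<open>T\<close>
  and \<open>w = T v\<close>.\<close>

definition self_adjoint_op :: "'h::real_inner set \<Rightarrow> ('h \<Rightarrow> 'h) \<Rightarrow> bool" where
  "self_adjoint_op D T \<longleftrightarrow>
     subspace D \<and> closure D = UNIV \<and>
     (\<forall>x\<in>D. \<forall>y\<in>D. T (x + y) = T x + T y) \<and>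
     (\<forall>c. \<forall>x\<in>D. T (c *\<^sub>R x) = c *\<^sub>R T x) \<and>
     (\<forall>v w. (\<forall>u\<in>D. T u \<bullet> v = u \<bullet> w) \<longleftrightarrow> v \<in> D \<and> w = T v)"

definition positive_op :: "'h::real_inner set \<Rightarrow> ('h \<Rightarrow> 'h) \<Rightarrow> bool" where
  "positive_op D T \<longleftrightarrow> (\<forall>u\<in>D. u \<noteq> 0 \<longrightarrow> 0 < T u \<bullet> u)"

text \<open>\<open>R\<close> with domain \<open>DR\<close> is the nonnegative self-adjoint square root of \<open>A\<close>;
  \<open>R \<circ> R = A\<close> includes equality of domains.\<close>

definition op_sqrt :: "'h::real_inner set \<Rightarrow> ('h \<Rightarrow> 'h) \<Rightarrow> 'h set \<Rightarrow> ('h \<Rightarrow> 'h) \<Rightarrow> bool" where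
  "op_sqrt DA A DR R \<longleftrightarrow>
     self_adjoint_op DR R \<and> (\<forall>u\<in>DR. 0 \<le> R u \<bullet> u) \<and>
     DA = {u \<in> DR. R u \<in> DR} \<and> (\<forall>u\<in>DA. R (R u) = A u)"


section \<open>Bochner integration without separability\<close>

text \<open>The library's \<^const>\<open>has_bochner_integral\<close> is restricted to second countable value spaces.
  The Hilbert spaces here need not be separable, so the same approximation by simple
  functions is used, with strong measurability in place of Borel measurability.\<close>

definition strongly_measurable :: "'a measure \<Rightarrow> ('a \<Rightarrow> 'b::real_normed_vector) \<Rightarrow> bool" where
  "strongly_measurable M f \<longleftrightarrow>
     (\<exists>s. (\<forall>i::nat. simple_function M (s i)) \<and> (AE x in M. (\<lambda>i. s i x) \<longlonglongrightarrow> f x))"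

definition bochner_has_integral ::
    "'a measure \<Rightarrow> ('a \<Rightarrow> 'b::real_normed_vector) \<Rightarrow> 'b \<Rightarrow> bool" where
  "bochner_has_integral M f I \<longleftrightarrow>
     strongly_measurable M f \<and>
     (\<exists>s. (\<forall>i::nat. Bochner_Integration.simple_bochner_integrable M (s i)) \<and>
          (\<lambda>i. \<integral>\<^sup>+x. ennreal (norm (f x - s i x)) \<partial>M) \<longlonglongrightarrow> 0 \<and>
          (\<lambda>i. Bochner_Integration.simple_bochner_integral M (s i)) \<longlonglongrightarrow> I)"


section \<open>Strongly continuous semigroups\<close>

definition C0_semigroup :: "(real \<Rightarrow> 'x::real_normed_vector \<Rightarrow> 'x) \<Rightarrow> bool" where
  "C0_semigroup S \<longleftrightarrow>
     (\<forall>t\<ge>0. bounded_linear (S t)) \<and>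
     (\<forall>x. S 0 x = x) \<and>
     (\<forall>s\<ge>0. \<forall>t\<ge>0. \<forall>x. S (s + t) x = S s (S t x)) \<and>
     (\<forall>x. ((\<lambda>t. S t x) \<longlongrightarrow> x) (at_right 0))"

definition generator_graph :: "(real \<Rightarrow> 'x::real_normed_vector \<Rightarrow> 'x) \<Rightarrow> ('x \<times> 'x) set" where
  "generator_graph S = {(x, y). ((\<lambda>h. (S h x - x) /\<^sub>R h) \<longlongrightarrow> y) (at_right 0)}"


section \<open>The phase space\<close>

definition k_mass :: "(real \<Rightarrow> real) \<Rightarrow> real" where
  "k_mass k = (LINT s|lebesgue_on {0<..}. k s)"

text \<open>Representatives of the elements of \<open>L\<^sup>2\<^sub>k((0,\<infinity>);D(\<surd>A))\<close>. The space \<open>D(\<surd>A)\<close>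
  carries the norm \<open>\<parallel>\<surd>A \<cdot>\<parallel>\<close>, so measurability and integrals of \<open>D(\<surd>A)\<close>-valued
  functions are those of their images under \<open>\<surd>A\<close>.\<close>

definition L2_memory :: "'h::real_inner set \<Rightarrow> ('h \<Rightarrow> 'h) \<Rightarrow> (real \<Rightarrow> real) \<Rightarrow> (real \<Rightarrow> 'h) set" where
  "L2_memory DR R k =
     {w. (\<forall>s>0. w s \<in> DR) \<and>
         strongly_measurable (lebesgue_on {0<..}) (\<lambda>s. R (w s)) \<and>
         integrable (lebesgue_on {0<..}) (\<lambda>s. k s * (norm (R (w s)))\<^sup>2)}"

definition sqrt_has_integral ::
    "'h::real_inner set \<Rightarrow> ('h \<Rightarrow> 'h) \<Rightarrow> real measure \<Rightarrow> (real \<Rightarrow> 'h) \<Rightarrow> 'h \<Rightarrow> bool" where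
  "sqrt_has_integral DR R M w q \<longleftrightarrow>
     q \<in> DR \<and> bochner_has_integral M (\<lambda>s. R (w s)) (R q)"

text \<open>\<open>w\<^sub>s = z\<close> and \<open>w(0) = 0\<close>, i.e.\ \<open>w\<close> is the absolutely continuous primitive of \<open>z\<close> that
  vanishes at \<open>0\<close>. Since \<open>exp (\<zeta> s) k(s)\<close> is nonincreasing, \<open>{s. k s > 0}\<close> is an
  interval starting at \<open>0\<close>; where \<open>k\<close> vanishes, elements of the weighted space carry no information.\<close>

definition memory_deriv ::
    "'h::real_inner set \<Rightarrow> ('h \<Rightarrow> 'h) \<Rightarrow> (real \<Rightarrow> real) \<Rightarrow> (real \<Rightarrow> 'h) \<Rightarrow> (real \<Rightarrow> 'h) \<Rightarrow> bool" where
  "memory_deriv DR R k w z \<longleftrightarrow>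
     (\<forall>s>0. k s > 0 \<longrightarrow> sqrt_has_integral DR R (lebesgue_on {0<..s}) z (w s))"

definition phase_reps ::
    "'h::real_inner set \<Rightarrow> ('h \<Rightarrow> 'h) \<Rightarrow> (real \<Rightarrow> real) \<Rightarrow> ('h \<times> 'h \<times> (real \<Rightarrow> 'h)) set" where
  "phase_reps DR R k = DR \<times> UNIV \<times> L2_memory DR R k"

fun phase_inner ::
    "('h::real_inner \<Rightarrow> 'h) \<Rightarrow> (real \<Rightarrow> real) \<Rightarrow> 'h \<times> 'h \<times> (real \<Rightarrow> 'h) \<Rightarrow> 'h \<times> 'h \<times> (real \<Rightarrow> 'h) \<Rightarrow> real" where
  "phase_inner R k (u, v, w) (u', v', w') =
     (1 - k_mass k) * (R u \<bullet> R u') + v \<bullet> v' +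
     (LINT s|lebesgue_on {0<..}. k s * (R (w s) \<bullet> R (w' s)))"

text \<open>Elements of the phase space are triples whose third component is a class of functions
  modulo null sets, and the space depends on the operator and on the kernel, so it cannot be
  introduced as a type constructor. Instead, \<open>E\<close> is the quotient map from representatives
  onto a Hilbert space type \<open>'x\<close>: linear, onto, and preserving the inner product. This
  determines \<open>'x\<close> up to isometric isomorphism; in particular two representatives are
  identified iff their difference has norm zero.\<close>

definition phase_space_map ::
    "'h::real_inner set \<Rightarrow> ('h \<Rightarrow> 'h) \<Rightarrow> (real \<Rightarrow> real) \<Rightarrow>
     ('h \<times> 'h \<times> (real \<Rightarrow> 'h) \<Rightarrow> 'x::{real_inner, complete_space}) \<Rightarrow> bool" where
  "phase_space_map DR R k E \<longleftrightarrow>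
     (\<forall>u v w u' v' w'. (u, v, w) \<in> phase_reps DR R k \<longrightarrow> (u', v', w') \<in> phase_reps DR R k \<longrightarrow>
        E (u + u', v + v', \<lambda>s. w s + w' s) = E (u, v, w) + E (u', v', w')) \<and>
     (\<forall>c u v w. (u, v, w) \<in> phase_reps DR R k \<longrightarrow>
        E (c *\<^sub>R u, c *\<^sub>R v, \<lambda>s. c *\<^sub>R w s) = c *\<^sub>R E (u, v, w)) \<and>
     (\<forall>X\<in>phase_reps DR R k. \<forall>Y\<in>phase_reps DR R k. E X \<bullet> E Y = phase_inner R k X Y) \<and>
     E ` phase_reps DR R k = UNIV"

text \<open>The first two components of an element; they do not depend on the representative.\<close>

definition pos_part ::
    "'h::real_inner set \<Rightarrow> ('h \<Rightarrow> 'h) \<Rightarrow> (real \<Rightarrow> real) \<Rightarrow>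
     ('h \<times> 'h \<times> (real \<Rightarrow> 'h) \<Rightarrow> 'x) \<Rightarrow> 'x \<Rightarrow> 'h" where
  "pos_part DR R k E X = fst (inv_into (phase_reps DR R k) E X)"

definition vel_part ::
    "'h::real_inner set \<Rightarrow> ('h \<Rightarrow> 'h) \<Rightarrow> (real \<Rightarrow> real) \<Rightarrow>
     ('h \<times> 'h \<times> (real \<Rightarrow> 'h) \<Rightarrow> 'x) \<Rightarrow> 'x \<Rightarrow> 'h" where
  "vel_part DR R k E X = fst (snd (inv_into (phase_reps DR R k) E X))"


section \<open>The abstract problem\<close>

text \<open>The second component of the operator, formally \<open>-(1 - k\<^sub>m)Au - \<integral> k(s) A w(s) ds\<close>
  with \<open>k\<^sub>m\<close> the integral of \<open>k\<close>, is \<open>-A((1 - k\<^sub>m)u + q)\<close> where \<open>q = \<integral> k(s) w(s) ds\<close>.\<close>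

definition wave_op_graph ::
    "'h::real_inner set \<Rightarrow> ('h \<Rightarrow> 'h) \<Rightarrow> 'h set \<Rightarrow> ('h \<Rightarrow> 'h) \<Rightarrow> (real \<Rightarrow> real) \<Rightarrow>
     ('h \<times> 'h \<times> (real \<Rightarrow> 'h) \<Rightarrow> 'x) \<Rightarrow> ('x \<times> 'x) set" where
  "wave_op_graph DA A DR R k E =
     {(E (u, v, w), E (v, - A ((1 - k_mass k) *\<^sub>R u + q), \<lambda>s. - z s + v)) | u v w z q.
        u \<in> DR \<and> v \<in> DR \<and> w \<in> L2_memory DR R k \<and> z \<in> L2_memory DR R k \<and>
        memory_deriv DR R k w z \<and>
        q \<in> DR \<and> bochner_has_integral (lebesgue_on {0<..}) (\<lambda>s. k s *\<^sub>R R (w s)) (R q) \<and>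
        (1 - k_mass k) *\<^sub>R u + q \<in> DA}"

definition delay_op ::
    "'h::real_inner set \<Rightarrow> ('h \<Rightarrow> 'h) \<Rightarrow> (real \<Rightarrow> real) \<Rightarrow>
     ('h \<times> 'h \<times> (real \<Rightarrow> 'h) \<Rightarrow> 'x) \<Rightarrow> ('h \<Rightarrow> 'h) \<Rightarrow> ('h \<Rightarrow> 'h) \<Rightarrow> 'x \<Rightarrow> 'x" where
  "delay_op DR R k E B Bs X = E (0, - B (Bs (vel_part DR R k E X)), \<lambda>s. 0)"

definition nonlin_map ::
    "'h::real_inner set \<Rightarrow> ('h \<Rightarrow> 'h) \<Rightarrow> (real \<Rightarrow> real) \<Rightarrow>
     ('h \<times> 'h \<times> (real \<Rightarrow> 'h) \<Rightarrow> 'x) \<Rightarrow> ('h \<Rightarrow> 'h) \<Rightarrow> ('h \<Rightarrow> 'h) \<Rightarrow> 'x \<Rightarrow> 'x \<Rightarrow> 'x" where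
  "nonlin_map DR R k E G1 G2 X Y =
     E (0, G1 (pos_part DR R k E X) + G2 (pos_part DR R k E Y), \<lambda>s. 0)"

text \<open>\<open>G u\<close> represents the Gateaux derivative of \<open>\<psi>\<close> at \<open>u\<close>, which is a linear functional
  on \<open>D\<close> bounded in the norm of the ambient space.\<close>

definition riesz_gradient ::
    "'h::real_inner set \<Rightarrow> ('h \<Rightarrow> real) \<Rightarrow> ('h \<Rightarrow> 'h) \<Rightarrow> bool" where
  "riesz_gradient D \<psi> G \<longleftrightarrow>
     (\<forall>u\<in>D. \<exists>D\<psi>.
        (\<forall>v\<in>D. \<forall>w\<in>D. D\<psi> (v + w) = D\<psi> v + D\<psi> w) \<and>
        (\<forall>c. \<forall>v\<in>D. D\<psi> (c *\<^sub>R v) = c * D\<psi> v) \<and>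
        (\<forall>v\<in>D. ((\<lambda>t. (\<psi> (u + t *\<^sub>R v) - \<psi> u) / t) \<longlongrightarrow> D\<psi> v) (at 0)) \<and>
        (\<exists>c>0. \<forall>v\<in>D. \<bar>D\<psi> v\<bar> \<le> c * norm v) \<and>
        (\<forall>v\<in>D. G u \<bullet> v = D\<psi> v))"

definition mild_solution ::
    "real \<Rightarrow> (real \<Rightarrow> 'x::real_normed_vector \<Rightarrow> 'x) \<Rightarrow> (real \<Rightarrow> real) \<Rightarrow> ('x \<Rightarrow> 'x) \<Rightarrow>
     ('x \<Rightarrow> 'x \<Rightarrow> 'x) \<Rightarrow> (real \<Rightarrow> 'x) \<Rightarrow> (real \<Rightarrow> 'x) \<Rightarrow> bool" where
  "mild_solution \<tau> S \<alpha> Bh Fh \<Phi> U \<longleftrightarrow>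
     continuous_on {-\<tau>..} U \<and>
     (\<forall>t\<in>{-\<tau>..0}. U t = \<Phi> t) \<and>
     (\<forall>t\<ge>0. \<exists>I.
        bochner_has_integral (lebesgue_on {0..t})
          (\<lambda>s. S (t - s) (\<alpha> s *\<^sub>R Bh (U (s - \<tau>)) + Fh (U s) (U (s - \<tau>)))) I \<and>
        U t = S t (\<Phi> 0) + I)"

end

theory Submission
  imports Defs
begin

text \<open>
  In the phase space the problem is a semilinear delay equation
  \<open>U' = \<Lambda>U + \<alpha>(t) B U(t - \<tau>) + F(U(t), U(t - \<tau>))\<close> whose linear part generates an
  exponentially stable semigroup, whose delay operator \<open>B\<close> is bounded, and whose nonlinearity
  vanishes at the origin and is Lipschitz on the ball of radius \<open>r\<close> with a constant \<open>L r\<close> that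
  tends to \<open>0\<close> with \<open>r\<close>. The theorem is a statement about such equations.

  Let \<open>U\<close> and \<open>V\<close> be continuous functions with values in the ball of radius \<open>r\<close>, let
  \<open>\<phi>(t) = exp (\<omega> t) \<parallel>U t - V t\<parallel>\<close>, and let \<open>I\<close> and \<open>J\<close> be the integrals in the
  variation of constants formula for \<open>U\<close> and \<open>V\<close> at time \<open>t\<close>. Then
  \<open>exp (\<omega> t) \<parallel>I - J\<parallel>\<close> is at most
  \<open>\<integral>\<^sub>0\<^sup>t (M b exp (\<omega> \<tau>) \<bar>\<alpha> s\<bar> \<phi>(s - \<tau>) + M (L r) (\<phi>(s) + exp (\<omega> \<tau>) \<phi>(s - \<tau>))) ds\<close>.
  Shifting the delayed terms by \<open>\<tau>\<close> leaves a constant multiple of the size of the history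
  plus \<open>\<integral>\<^sub>0\<^sup>t a \<phi>\<close>, where
  \<open>a(s) = M b exp (\<omega> \<tau>) \<bar>\<alpha>(s + \<tau>)\<bar> + M (L r) (1 + exp (\<omega> \<tau>))\<close>
  (lemma \<open>duhamel_difference_le\<close>). Let \<open>A\<close> be the primitive of \<open>a\<close>. Since
  \<open>\<integral>\<^sub>0\<^sup>t a exp (c A) \<le> (exp (c A(t)) - 1) / c\<close> (lemma \<open>integral_exp_majorant_le\<close>), this
  estimate can be closed in norms weighted by \<open>exp (c A)\<close>, and it is used three times:

  \<^item> with \<open>V = 0\<close> and \<open>c = 1\<close>, Duhamel's formula maps the set of all \<open>U\<close> with
    \<open>\<parallel>U t\<parallel> \<le> K exp (A(t) - \<omega> t)\<close> to itself, where \<open>K\<close> is proportional to the size of the history;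
  \<^item> with equal histories and \<open>c = 2\<close>, Duhamel's formula is a contraction with factor \<open>1/2\<close> on
    this set in the weighted supremum norm, which gives a solution on the whole half line at once;
  \<^item> with two arbitrary solutions, bounded on compact intervals by continuity, \<open>c = 2\<close> gives
    \<open>\<phi> = 0\<close>, hence uniqueness among all mild solutions.

  The constant \<open>C\<close> is chosen with \<open>M (L C) (1 + exp (\<omega> \<tau>)) < \<omega> - \<omega>'\<close>. The smallness
  condition on \<open>\<alpha>\<close> then implies \<open>A(t) \<le> \<gamma> + \<omega> t\<close>, so the set above lies in the ball of radius
  \<open>K exp \<gamma>\<close>, which is at most \<open>C\<close> when the history is small.
  The iteration therefore never leaves the ball on which \<open>L C\<close> is a Lipschitz constant.
\<close>

section \<open>Bochner integrals of strongly measurable functions\<close>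

lemma complete_measure_lebesgue_on:
  assumes "T \<in> sets lebesgue"
  shows "complete_measure (lebesgue_on T)"
proof
  fix A B assume "B \<subseteq> A" "A \<in> null_sets (lebesgue_on T)"
  then have "A \<in> null_sets lebesgue" "A \<subseteq> T"
    using assms by (auto simp: null_sets_restrict_space)
  then have "B \<in> null_sets lebesgue"
    using \<open>B \<subseteq> A\<close> completion.complete2 by blast
  then show "B \<in> sets (lebesgue_on T)"
    using \<open>A \<subseteq> T\<close> \<open>B \<subseteq> A\<close> assms by (auto simp: sets_restrict_space_iff)
qed

text \<open>Strong measurability is an almost everywhere limit property, so norms of
  strongly measurable functions are Borel measurable only up to null sets;
  completeness of the measure removes this defect.\<close>

lemma borel_measurable_AE_cong_complete:
  fixes f g :: "'a \<Rightarrow> real"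
  assumes "complete_measure M" "f \<in> borel_measurable M" "AE x in M. f x = g x"
  shows "g \<in> borel_measurable M"
proof (rule measurableI)
  interpret complete_measure M by fact
  fix X :: "real set" assume X: "X \<in> sets borel"
  show "g -` X \<inter> space M \<in> sets M"
  proof (rule in_sets_AE)
    show "AE x in M. x \<in> f -` X \<inter> space M \<longleftrightarrow> x \<in> g -` X \<inter> space M"
      using assms(3) by eventually_elim auto
    show "f -` X \<inter> space M \<in> sets M" using X assms(2) by (rule measurable_sets[rotated])
  qed auto
qed simp

lemma strongly_measurable_norm:
  fixes f :: "'a \<Rightarrow> 'b::real_normed_vector"
  assumes "complete_measure M" "strongly_measurable M f"
  shows "(\<lambda>x. norm (f x)) \<in> borel_measurable M"
proof -
  obtain s where s: "\<And>i::nat. simple_function M (s i)" "AE x in M. (\<lambda>i. s i x) \<longlonglongrightarrow> f x"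
    using assms(2) unfolding strongly_measurable_def by blast
  have [measurable]: "(\<lambda>x. norm (s i x)) \<in> borel_measurable M" for i
    by (intro borel_measurable_simple_function simple_function_compose1[OF s(1)])
  have "(\<lambda>x. lim (\<lambda>i. norm (s i x))) \<in> borel_measurable M"
    by measurable
  moreover have "AE x in M. lim (\<lambda>i. norm (s i x)) = norm (f x)"
    using s(2) by eventually_elim (auto intro!: limI tendsto_norm)
  ultimately show ?thesis
    by (rule borel_measurable_AE_cong_complete[OF assms(1)])
qed

lemma strongly_measurable_simple_function:
  "simple_function M f \<Longrightarrow> strongly_measurable M f"
  unfolding strongly_measurable_def by (intro exI[of _ "\<lambda>_. f"]) auto

text \<open>Applying \<open>h\<close> to simple approximations of both arguments gives simple
  approximations of the result. This covers sums, differences and scalar multiples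
  without any separability of the value space.\<close>

lemma strongly_measurable_compose2:
  assumes "strongly_measurable M f" "strongly_measurable M g"
    and "\<And>x y. isCont (\<lambda>(u, v). h u v) (x, y)"
  shows "strongly_measurable M (\<lambda>x. h (f x) (g x))"
proof -
  obtain s where s: "\<And>i::nat. simple_function M (s i)" "AE x in M. (\<lambda>i. s i x) \<longlonglongrightarrow> f x"
    using assms(1) unfolding strongly_measurable_def by blast
  obtain t where t: "\<And>i::nat. simple_function M (t i)" "AE x in M. (\<lambda>i. t i x) \<longlonglongrightarrow> g x"
    using assms(2) unfolding strongly_measurable_def by blast
  have "AE x in M. (\<lambda>i. h (s i x) (t i x)) \<longlonglongrightarrow> h (f x) (g x)"
    using s(2) t(2)
  proof eventually_elim
    case (elim x)
    then have "(\<lambda>i. (s i x, t i x)) \<longlonglongrightarrow> (f x, g x)" by (intro tendsto_Pair)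
    from isCont_tendsto_compose[OF assms(3) this] show ?case by simp
  qed
  then show ?thesis
    unfolding strongly_measurable_def
    by (intro exI[of _ "\<lambda>i x. h (s i x) (t i x)"] conjI allI simple_function_compose2[OF s(1) t(1)])
qed

lemma strongly_measurable_add:
  assumes "strongly_measurable M f" "strongly_measurable M g"
  shows "strongly_measurable M (\<lambda>x. f x + g x)"
  by (rule strongly_measurable_compose2[OF assms]) (auto simp: split_def intro!: continuous_intros)

lemma strongly_measurable_diff:
  assumes "strongly_measurable M f" "strongly_measurable M g"
  shows "strongly_measurable M (\<lambda>x. f x - g x)"
  by (rule strongly_measurable_compose2[OF assms]) (auto simp: split_def intro!: continuous_intros)

lemma strongly_measurable_scaleR:
  assumes "strongly_measurable M f" "strongly_measurable M g"
  shows "strongly_measurable M (\<lambda>x. f x *\<^sub>R g x)"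
  by (rule strongly_measurable_compose2[OF assms]) (auto simp: split_def intro!: continuous_intros)

lemma strongly_measurable_real:
  fixes f :: "'a \<Rightarrow> real"
  assumes "f \<in> borel_measurable M"
  shows "strongly_measurable M f"
proof -
  obtain s where "\<And>i. simple_function M (s i)" "\<And>x. x \<in> space M \<Longrightarrow> (\<lambda>i. s i x) \<longlonglongrightarrow> f x"
    using borel_measurable_implies_sequence_metric[OF assms, of 0] by metis
  then show ?thesis
    unfolding strongly_measurable_def by (intro exI[of _ s]) auto
qed

text \<open>Evaluating \<open>f\<close> at the argument rounded down to a multiple of \<open>1/(i+1)\<close> gives a
  function with finitely many values that converges to \<open>f\<close>; the maximum with \<open>a\<close> keeps
  the rounded argument in the interval.\<close>

lemma strongly_measurable_continuous_on:
  fixes f :: "real \<Rightarrow> 'b::real_normed_vector"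
  assumes f: "continuous_on {a..b} f"
  shows "strongly_measurable (lebesgue_on {a..b}) f"
proof -
  define r where "r i x = max a (of_int \<lfloor>(real (Suc i)) * x\<rfloor> / real (Suc i))" for i :: nat and x :: real
  have lim: "(\<lambda>i. r i x) \<longlonglongrightarrow> x" if "x \<in> {a..b}" for x
  proof -
    have "(\<lambda>i. of_int \<lfloor>(real (Suc i)) * x\<rfloor> / real (Suc i)) \<longlonglongrightarrow> x"
    proof (rule real_tendsto_sandwich)
      show "\<forall>\<^sub>F i in sequentially. x - inverse (real (Suc i)) \<le> of_int \<lfloor>(real (Suc i)) * x\<rfloor> / real (Suc i)"
      proof (intro always_eventually allI)
        fix i
        have "real (Suc i) * x - 1 \<le> of_int \<lfloor>(real (Suc i)) * x\<rfloor>" by linarith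
        then have "(real (Suc i) * x - 1) / real (Suc i) \<le> of_int \<lfloor>(real (Suc i)) * x\<rfloor> / real (Suc i)"
          by (intro divide_right_mono) auto
        then show "x - inverse (real (Suc i)) \<le> of_int \<lfloor>(real (Suc i)) * x\<rfloor> / real (Suc i)"
          by (simp add: diff_divide_distrib inverse_eq_divide del: of_nat_Suc)
      qed
      show "\<forall>\<^sub>F i in sequentially. of_int \<lfloor>(real (Suc i)) * x\<rfloor> / real (Suc i) \<le> x"
      proof (intro always_eventually allI)
        fix i
        have "of_int \<lfloor>(real (Suc i)) * x\<rfloor> \<le> real (Suc i) * x" by linarith
        then show "of_int \<lfloor>(real (Suc i)) * x\<rfloor> / real (Suc i) \<le> x"
          by (simp add: divide_le_eq mult.commute del: of_nat_Suc)
      qed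
      show "(\<lambda>i. x - inverse (real (Suc i))) \<longlonglongrightarrow> x"
        using tendsto_diff[OF tendsto_const LIMSEQ_inverse_real_of_nat, of x] by simp
    qed simp
    then have "(\<lambda>i. r i x) \<longlonglongrightarrow> max a x" unfolding r_def by (intro tendsto_max tendsto_const)
    then show ?thesis using that by simp
  qed
  have mem: "r i x \<in> {a..b}" if "x \<in> {a..b}" for i x
  proof -
    have "of_int \<lfloor>(real (Suc i)) * x\<rfloor> \<le> real (Suc i) * x" by linarith
    then have "of_int \<lfloor>(real (Suc i)) * x\<rfloor> / real (Suc i) \<le> x"
      by (simp add: divide_le_eq mult.commute del: of_nat_Suc)
    then show ?thesis using that by (auto simp: r_def)
  qed
  have sim: "simple_function (lebesgue_on {a..b}) (r i)" for i
  proof (rule simple_function_borel_measurable)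
    have "r i \<in> borel_measurable borel" unfolding r_def by measurable
    then have "r i \<in> borel_measurable lebesgue" by (simp add: measurable_completion)
    then show "r i \<in> borel_measurable (lebesgue_on {a..b})" by (rule measurable_restrict_space1)
    have "r i ` {a..b} \<subseteq> (\<lambda>n. max a (of_int n / real (Suc i))) ` {\<lfloor>real (Suc i) * a\<rfloor>..\<lfloor>real (Suc i) * b\<rfloor>}"
    proof
      fix y assume "y \<in> r i ` {a..b}"
      then obtain x where x: "x \<in> {a..b}" "y = r i x" by blast
      then have "\<lfloor>real (Suc i) * x\<rfloor> \<in> {\<lfloor>real (Suc i) * a\<rfloor>..\<lfloor>real (Suc i) * b\<rfloor>}"
        by (auto intro!: floor_mono mult_left_mono simp del: of_nat_Suc)
      then show "y \<in> (\<lambda>n. max a (of_int n / real (Suc i))) ` {\<lfloor>real (Suc i) * a\<rfloor>..\<lfloor>real (Suc i) * b\<rfloor>}"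
        using x(2) unfolding r_def by blast
    qed
    then show "finite (r i ` space (lebesgue_on {a..b}))"
      using finite_subset[OF _ finite_imageI[OF finite_atLeastAtMost_int]] by (simp add: space_restrict_space del: of_nat_Suc)
  qed
  have "(\<lambda>i. f (r i x)) \<longlonglongrightarrow> f x" if "x \<in> {a..b}" for x
    by (rule continuous_on_tendsto_compose[OF f lim[OF that]]) (use that mem in auto)
  then show ?thesis
    unfolding strongly_measurable_def
    by (intro exI[of _ "\<lambda>i x. f (r i x)"] conjI allI simple_function_compose1[OF sim]) auto
qed

lemma bochner_has_integral_diff:
  assumes c: "complete_measure M"
    and f: "bochner_has_integral M f I" and g: "bochner_has_integral M g J"
  shows "bochner_has_integral M (\<lambda>x. f x - g x) (I - J)"
proof -
  note sm = f[unfolded bochner_has_integral_def, THEN conjunct1]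
    g[unfolded bochner_has_integral_def, THEN conjunct1]
  obtain s where s: "\<And>i::nat. Bochner_Integration.simple_bochner_integrable M (s i)"
      "(\<lambda>i. \<integral>\<^sup>+x. ennreal (norm (f x - s i x)) \<partial>M) \<longlonglongrightarrow> 0"
      "(\<lambda>i. Bochner_Integration.simple_bochner_integral M (s i)) \<longlonglongrightarrow> I"
    using f unfolding bochner_has_integral_def by blast
  obtain t where t: "\<And>i::nat. Bochner_Integration.simple_bochner_integrable M (t i)"
      "(\<lambda>i. \<integral>\<^sup>+x. ennreal (norm (g x - t i x)) \<partial>M) \<longlonglongrightarrow> 0"
      "(\<lambda>i. Bochner_Integration.simple_bochner_integral M (t i)) \<longlonglongrightarrow> J"
    using g unfolding bochner_has_integral_def by blast
  have st: "strongly_measurable M (s i)" "strongly_measurable M (t i)" for i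
    using s(1)[of i] t(1)[of i]
    by (auto intro!: strongly_measurable_simple_function elim: simple_bochner_integrable.cases)
  have [measurable]: "(\<lambda>x. norm (f x - s i x)) \<in> borel_measurable M" 
    "(\<lambda>x. norm (g x - t i x)) \<in> borel_measurable M" for i
    by (intro strongly_measurable_norm[OF c] strongly_measurable_diff sm st)+
  have "(\<lambda>i. \<integral>\<^sup>+x. ennreal (norm (f x - g x - (s i x - t i x))) \<partial>M) \<longlonglongrightarrow> 0"
  proof (rule tendsto_sandwich[OF _ _ tendsto_const])
    show "\<forall>\<^sub>F i in sequentially. 0 \<le> (\<integral>\<^sup>+x. ennreal (norm (f x - g x - (s i x - t i x))) \<partial>M)" by simp
    show "(\<lambda>i. (\<integral>\<^sup>+x. ennreal (norm (f x - s i x)) \<partial>M) + (\<integral>\<^sup>+x. ennreal (norm (g x - t i x)) \<partial>M)) \<longlonglongrightarrow> 0"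
      using tendsto_add[OF s(2) t(2)] by simp
    show "\<forall>\<^sub>F i in sequentially. (\<integral>\<^sup>+x. ennreal (norm (f x - g x - (s i x - t i x))) \<partial>M)
       \<le> (\<integral>\<^sup>+x. ennreal (norm (f x - s i x)) \<partial>M) + (\<integral>\<^sup>+x. ennreal (norm (g x - t i x)) \<partial>M)"
    proof (intro always_eventually allI)
      fix i
      have le: "norm (f x - g x - (s i x - t i x)) \<le> norm (f x - s i x) + norm (g x - t i x)" for x
        using norm_triangle_ineq4[of "f x - s i x" "g x - t i x"] by (simp add: algebra_simps)
      have "(\<integral>\<^sup>+x. ennreal (norm (f x - g x - (s i x - t i x))) \<partial>M)
        \<le> (\<integral>\<^sup>+x. ennreal (norm (f x - s i x)) + ennreal (norm (g x - t i x)) \<partial>M)"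
        by (intro nn_integral_mono) (simp add: ennreal_plus[symmetric] le del: ennreal_plus)
      also have "\<dots> = (\<integral>\<^sup>+x. ennreal (norm (f x - s i x)) \<partial>M) + (\<integral>\<^sup>+x. ennreal (norm (g x - t i x)) \<partial>M)"
        by (rule nn_integral_add) auto
      finally show "(\<integral>\<^sup>+x. ennreal (norm (f x - g x - (s i x - t i x))) \<partial>M)
       \<le> (\<integral>\<^sup>+x. ennreal (norm (f x - s i x)) \<partial>M) + (\<integral>\<^sup>+x. ennreal (norm (g x - t i x)) \<partial>M)" .
    qed
  qed
  moreover have "(\<lambda>i. Bochner_Integration.simple_bochner_integral M (\<lambda>x. s i x - t i x)) \<longlonglongrightarrow> I - J"
    using tendsto_diff[OF s(3) t(3)] s(1) t(1) by (simp add: simple_bochner_integral_diff)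
  moreover have "\<And>i. Bochner_Integration.simple_bochner_integrable M (\<lambda>x. s i x - t i x)"
    by (rule simple_bochner_integrable_compose2[OF _ s(1) t(1)]) simp
  ultimately show ?thesis
    unfolding bochner_has_integral_def using strongly_measurable_diff[OF sm] 
    by (intro conjI exI[of _ "\<lambda>i x. s i x - t i x"]) auto
qed

lemma norm_simple_bochner_integral_le_nn_integral:
  assumes s: "Bochner_Integration.simple_bochner_integrable M s"
  shows "ennreal (norm (Bochner_Integration.simple_bochner_integral M s)) \<le> (\<integral>\<^sup>+x. ennreal (norm (s x)) \<partial>M)"
proof -
  have "Bochner_Integration.simple_bochner_integrable M (\<lambda>x. norm (s x))"
    using simple_bochner_integrable_compose2[of "\<lambda>a b. norm a", OF _ s s] by simp
  then have "ennreal (Bochner_Integration.simple_bochner_integral M (\<lambda>x. norm (s x))) = (\<integral>\<^sup>+x. ennreal (norm (s x)) \<partial>M)"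
    by (rule simple_bochner_integral_eq_nn_integral) auto
  then show ?thesis
    using simple_bochner_integral_norm_bound[OF s] by (metis ennreal_leI)
qed

text \<open>The inequality is elementary for simple functions and survives the \<open>L\<^sup>1\<close> limit
  in the definition of the integral.\<close>

lemma norm_bochner_integral_le_nn_integral:
  assumes c: "complete_measure M" and f: "bochner_has_integral M f I"
  shows "ennreal (norm I) \<le> (\<integral>\<^sup>+x. ennreal (norm (f x)) \<partial>M)"
proof -
  note sm = f[unfolded bochner_has_integral_def, THEN conjunct1]
  obtain s where s: "\<And>i::nat. Bochner_Integration.simple_bochner_integrable M (s i)"
      "(\<lambda>i. \<integral>\<^sup>+x. ennreal (norm (f x - s i x)) \<partial>M) \<longlonglongrightarrow> 0"
      "(\<lambda>i. Bochner_Integration.simple_bochner_integral M (s i)) \<longlonglongrightarrow> I"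
    using f unfolding bochner_has_integral_def by blast
  have st: "strongly_measurable M (s i)" for i
    using s(1)[of i]
    by (auto intro!: strongly_measurable_simple_function elim: simple_bochner_integrable.cases)
  have [measurable]: "(\<lambda>x. norm (f x - s i x)) \<in> borel_measurable M" 
    "(\<lambda>x. norm (f x)) \<in> borel_measurable M" for i
    by (intro strongly_measurable_norm[OF c] strongly_measurable_diff sm st)+
  show ?thesis
  proof (rule LIMSEQ_le)
    show "(\<lambda>i. ennreal (norm (Bochner_Integration.simple_bochner_integral M (s i)))) \<longlonglongrightarrow> ennreal (norm I)"
      by (intro tendsto_ennrealI tendsto_norm s(3))
    show "(\<lambda>i. (\<integral>\<^sup>+x. ennreal (norm (f x)) \<partial>M) + (\<integral>\<^sup>+x. ennreal (norm (f x - s i x)) \<partial>M)) \<longlonglongrightarrow> (\<integral>\<^sup>+x. ennreal (norm (f x)) \<partial>M)"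
      using tendsto_add[OF tendsto_const s(2)] by simp
    show "\<exists>N. \<forall>i\<ge>N. ennreal (norm (Bochner_Integration.simple_bochner_integral M (s i)))
        \<le> (\<integral>\<^sup>+x. ennreal (norm (f x)) \<partial>M) + (\<integral>\<^sup>+x. ennreal (norm (f x - s i x)) \<partial>M)"
    proof (intro exI allI impI)
      fix i
      have le: "norm (s i x) \<le> norm (f x) + norm (f x - s i x)" for x
        using norm_triangle_ineq4[of "f x" "f x - s i x"] by simp
      have "ennreal (norm (Bochner_Integration.simple_bochner_integral M (s i))) \<le> (\<integral>\<^sup>+x. ennreal (norm (s i x)) \<partial>M)"
        by (rule norm_simple_bochner_integral_le_nn_integral[OF s(1)])
      also have "\<dots> \<le> (\<integral>\<^sup>+x. ennreal (norm (f x)) + ennreal (norm (f x - s i x)) \<partial>M)"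
        by (intro nn_integral_mono) (simp add: ennreal_plus[symmetric] le del: ennreal_plus)
      also have "\<dots> = (\<integral>\<^sup>+x. ennreal (norm (f x)) \<partial>M) + (\<integral>\<^sup>+x. ennreal (norm (f x - s i x)) \<partial>M)"
        by (rule nn_integral_add) auto
      finally show "ennreal (norm (Bochner_Integration.simple_bochner_integral M (s i)))
        \<le> (\<integral>\<^sup>+x. ennreal (norm (f x)) \<partial>M) + (\<integral>\<^sup>+x. ennreal (norm (f x - s i x)) \<partial>M)" .
    qed
  qed
qed

lemma norm_bochner_integral_le:
  assumes "complete_measure M" "bochner_has_integral M f I"
    and "integrable M g" "\<And>x. x \<in> space M \<Longrightarrow> norm (f x) \<le> g x"
  shows "norm I \<le> (LINT x|M. g x)"
proof -
  have g0: "0 \<le> g x" if "x \<in> space M" for x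
    using assms(4)[OF that] norm_ge_zero order_trans by blast
  have "ennreal (norm I) \<le> (\<integral>\<^sup>+x. ennreal (norm (f x)) \<partial>M)"
    by (rule norm_bochner_integral_le_nn_integral) fact+
  also have "\<dots> \<le> (\<integral>\<^sup>+x. ennreal (g x) \<partial>M)"
    by (intro nn_integral_mono ennreal_leI assms)
  also have "\<dots> = ennreal (LINT x|M. g x)"
    using assms(3) g0 by (intro nn_integral_eq_integral) auto
  finally show ?thesis
    using g0 by (simp add: ennreal_le_iff integral_nonneg_AE)
qed

text \<open>The criterion of Bochner: a strongly measurable function with integrable norm is
  integrable. The simple functions \<open>s i\<close> that converge to \<open>f\<close> need not converge in
  \<open>L\<^sup>1\<close>, so they are cut off to \<open>0\<close> wherever \<open>\<parallel>s i\<parallel> > 2 \<parallel>f\<parallel>\<close>. This does not affect the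
  pointwise limit and makes \<open>3 \<parallel>f\<parallel>\<close> a dominating function. Completeness of the value
  space provides the limit of the integrals.\<close>

lemma bochner_has_integral_exists:
  fixes f :: "'a \<Rightarrow> 'b::{real_normed_vector, complete_space}"
  assumes c: "complete_measure M" and fin: "finite_measure M"
    and sm: "strongly_measurable M f" and int: "integrable M (\<lambda>x. norm (f x))"
  shows "\<exists>I. bochner_has_integral M f I"
proof -
  interpret finite_measure M by fact
  obtain s where s: "\<And>i::nat. simple_function M (s i)" "AE x in M. (\<lambda>i. s i x) \<longlonglongrightarrow> f x"
    using sm unfolding strongly_measurable_def by blast
  note [measurable] = strongly_measurable_norm[OF c sm]
  have [measurable]: "(\<lambda>x. norm (s i x)) \<in> borel_measurable M" for i
    by (intro borel_measurable_simple_function simple_function_compose1[OF s(1)])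
  define Z where "Z i = {x \<in> space M. norm (s i x) \<le> 2 * norm (f x)}" for i
  define t where "t i x = indicator (Z i) x *\<^sub>R s i x" for i x
  have ts: "simple_function M (t i)" for i
    unfolding t_def
    by (intro simple_function_compose2[where h="\<lambda>a b. a *\<^sub>R b"] s simple_function_indicator) (auto simp: Z_def)
  have ti: "Bochner_Integration.simple_bochner_integrable M (t i)" for i
    by (rule simple_bochner_integrable.intros[OF ts]) (simp add: emeasure_finite)
  have sti: "strongly_measurable M (t i)" for i
    by (rule strongly_measurable_simple_function[OF ts])
  have tb: "norm (f x - t i x) \<le> 3 * norm (f x)" if "x \<in> space M" for i x
    using that norm_triangle_ineq4[of "f x" "s i x"] by (auto simp: t_def Z_def indicator_def)
  have tl: "AE x in M. (\<lambda>i. norm (f x - t i x)) \<longlonglongrightarrow> 0"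
    using s(2) AE_space
  proof eventually_elim
    case (elim x)
    show ?case
    proof (cases "f x = 0")
      case True
      then have "t i x = 0" for i using elim by (auto simp: t_def Z_def indicator_def)
      then show ?thesis using True by simp
    next
      case False
      then have "\<forall>\<^sub>F i in sequentially. norm (s i x) < 2 * norm (f x)"
        using order_tendstoD(2)[OF tendsto_norm[OF elim(1)], of "2 * norm (f x)"] by simp
      then have "\<forall>\<^sub>F i in sequentially. norm (f x - s i x) = norm (f x - t i x)"
        by eventually_elim (use elim in \<open>auto simp: t_def Z_def\<close>)
      moreover have "(\<lambda>i. norm (f x - s i x)) \<longlonglongrightarrow> 0"
        using tendsto_norm[OF tendsto_diff[OF tendsto_const elim(1), of "f x"]] by simp
      ultimately show ?thesis by (rule Lim_transform_eventually[rotated])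
    qed
  qed
  have [measurable]: "(\<lambda>x. norm (f x - t i x)) \<in> borel_measurable M" for i
    by (intro strongly_measurable_norm[OF c] strongly_measurable_diff sm sti)
  have L1: "(\<lambda>i. \<integral>\<^sup>+x. ennreal (norm (f x - t i x)) \<partial>M) \<longlonglongrightarrow> 0"
  proof -
    have "(\<lambda>i. \<integral>\<^sup>+x. ennreal (norm (f x - t i x)) \<partial>M) \<longlonglongrightarrow> (\<integral>\<^sup>+x. 0 \<partial>M)"
    proof (rule nn_integral_dominated_convergence[where w="\<lambda>x. ennreal (3 * norm (f x))"])
      show "(\<integral>\<^sup>+ x. ennreal (3 * norm (f x)) \<partial>M) < \<infinity>"
        using integrable_mult_right[OF int, of 3] unfolding integrable_iff_bounded by simp
      show "AE x in M. (\<lambda>i. ennreal (norm (f x - t i x))) \<longlonglongrightarrow> 0"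
        using tl by eventually_elim (metis ennreal_0 tendsto_ennrealI)
    qed (use tb in \<open>auto intro!: ennreal_leI\<close>)
    then show ?thesis by simp
  qed
  define J where "J i = Bochner_Integration.simple_bochner_integral M (t i)" for i
  have J: "ennreal (norm (J i - J j)) \<le> (\<integral>\<^sup>+x. ennreal (norm (f x - t i x)) \<partial>M) + (\<integral>\<^sup>+x. ennreal (norm (f x - t j x)) \<partial>M)" for i j
  proof -
    have le: "norm (t i x - t j x) \<le> norm (f x - t i x) + norm (f x - t j x)" for x
      using norm_triangle_ineq4[of "f x - t j x" "f x - t i x"] by simp
    have "ennreal (norm (J i - J j)) \<le> (\<integral>\<^sup>+x. ennreal (norm (t i x - t j x)) \<partial>M)"
      using norm_simple_bochner_integral_le_nn_integral[OF simple_bochner_integrable_compose2[of "\<lambda>a b. a - b", OF _ ti ti]]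
      by (simp add: J_def simple_bochner_integral_diff[OF ti ti])
    also have "\<dots> \<le> (\<integral>\<^sup>+x. ennreal (norm (f x - t i x)) + ennreal (norm (f x - t j x)) \<partial>M)"
      by (intro nn_integral_mono) (simp add: ennreal_plus[symmetric] le del: ennreal_plus)
    also have "\<dots> = (\<integral>\<^sup>+x. ennreal (norm (f x - t i x)) \<partial>M) + (\<integral>\<^sup>+x. ennreal (norm (f x - t j x)) \<partial>M)"
      by (rule nn_integral_add) auto
    finally show ?thesis .
  qed
  have "Cauchy J"
  proof (rule metric_CauchyI)
    fix e :: real assume "e > 0"
    then have "\<forall>\<^sub>F i in sequentially. (\<integral>\<^sup>+x. ennreal (norm (f x - t i x)) \<partial>M) < ennreal (e/2)"
      by (intro order_tendstoD(2)[OF L1]) simp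
    then obtain N where N: "\<And>i. i \<ge> N \<Longrightarrow> (\<integral>\<^sup>+x. ennreal (norm (f x - t i x)) \<partial>M) < ennreal (e/2)"
      unfolding eventually_sequentially by blast
    have "dist (J i) (J j) < e" if "i \<ge> N" "j \<ge> N" for i j
    proof -
      have "ennreal (norm (J i - J j)) < ennreal (e/2) + ennreal (e/2)"
        using J[of i j] add_strict_mono[OF N[OF that(1)] N[OF that(2)]] by (rule le_less_trans)
      also have "\<dots> = ennreal e" using \<open>e > 0\<close> by (simp flip: ennreal_plus)
      finally show ?thesis by (simp add: dist_norm ennreal_less_iff)
    qed
    then show "\<exists>N. \<forall>m\<ge>N. \<forall>n\<ge>N. dist (J m) (J n) < e" by blast
  qed
  then obtain I where "J \<longlonglongrightarrow> I" by (auto simp: Cauchy_convergent_iff convergent_def)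
  then show ?thesis
    unfolding bochner_has_integral_def using sm ti L1 by (auto simp: J_def[abs_def])
qed

lemma bochner_has_integral_cong:
  assumes "\<And>x. x \<in> space M \<Longrightarrow> f x = g x"
  shows "bochner_has_integral M f I \<longleftrightarrow> bochner_has_integral M g I"
proof -
  have "(AE x in M. (\<lambda>i::nat. s i x) \<longlonglongrightarrow> f x) \<longleftrightarrow> (AE x in M. (\<lambda>i. s i x) \<longlonglongrightarrow> g x)" for s
    using assms by (intro AE_cong) auto
  moreover have "(\<integral>\<^sup>+x. ennreal (norm (f x - s x)) \<partial>M) = (\<integral>\<^sup>+x. ennreal (norm (g x - s x)) \<partial>M)" for s
    using assms by (intro nn_integral_cong) auto
  ultimately show ?thesis
    unfolding bochner_has_integral_def strongly_measurable_def by simp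
qed

text \<open>Integrals over different intervals become integrals over a common one, so that
  they can be subtracted from each other.\<close>

lemma bochner_has_integral_indicator:
  assumes \<Omega>: "\<Omega> \<in> sets M" and f: "bochner_has_integral (restrict_space M \<Omega>) f I"
  shows "bochner_has_integral M (\<lambda>x. indicator \<Omega> x *\<^sub>R f x) I"
proof -
  have \<Omega>': "\<Omega> \<inter> space M \<in> sets M" using \<Omega> by auto
  obtain r where r: "\<And>i::nat. simple_function (restrict_space M \<Omega>) (r i)" "AE x in restrict_space M \<Omega>. (\<lambda>i. r i x) \<longlonglongrightarrow> f x"
    using f unfolding bochner_has_integral_def strongly_measurable_def by blast
  obtain s where s: "\<And>i::nat. Bochner_Integration.simple_bochner_integrable (restrict_space M \<Omega>) (s i)"
      "(\<lambda>i. \<integral>\<^sup>+x. ennreal (norm (f x - s i x)) \<partial>restrict_space M \<Omega>) \<longlonglongrightarrow> 0"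
      "(\<lambda>i. Bochner_Integration.simple_bochner_integral (restrict_space M \<Omega>) (s i)) \<longlonglongrightarrow> I"
    using f unfolding bochner_has_integral_def by blast
  have "AE x in M. (\<lambda>i. indicator \<Omega> x *\<^sub>R r i x) \<longlonglongrightarrow> indicator \<Omega> x *\<^sub>R f x"
    using r(2) unfolding AE_restrict_space_iff[OF \<Omega>'] by eventually_elim (auto simp: indicator_def)
  then have "strongly_measurable M (\<lambda>x. indicator \<Omega> x *\<^sub>R f x)"
    unfolding strongly_measurable_def using r(1) unfolding simple_function_restrict_space[OF \<Omega>']
    by (intro exI[of _ "\<lambda>i x. indicator \<Omega> x *\<^sub>R r i x"]) auto
  moreover have "(\<integral>\<^sup>+x. ennreal (norm (indicator \<Omega> x *\<^sub>R f x - indicator \<Omega> x *\<^sub>R s i x)) \<partial>M)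
      = (\<integral>\<^sup>+x. ennreal (norm (f x - s i x)) \<partial>restrict_space M \<Omega>)" for i
    unfolding nn_integral_restrict_space[OF \<Omega>']
    by (intro nn_integral_cong) (auto simp: indicator_def)
  ultimately show ?thesis
    unfolding bochner_has_integral_def
    using s simple_bochner_integrable_restrict_space[OF \<Omega>', of "s _"]
      simple_bochner_integral_restrict_space[OF \<Omega>' s(1)]
    by (intro conjI exI[of _ "\<lambda>i x. indicator \<Omega> x *\<^sub>R s i x"]) auto
qed

section \<open>Integral inequalities for integrable weights\<close>

lemma absolutely_integrable_mult_continuous:
  fixes a g :: "real \<Rightarrow> real"
  assumes "a absolutely_integrable_on {c..d}" "continuous_on {c..d} g"
  shows "(\<lambda>s. a s * g s) absolutely_integrable_on {c..d}"
proof -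
  have "(\<lambda>s. g s * a s) absolutely_integrable_on {c..d}"
    by (intro absolutely_integrable_bounded_measurable_product_real assms
        continuous_imp_measurable_on_sets_lebesgue compact_imp_bounded compact_continuous_image) auto
  then show ?thesis by (simp add: mult.commute)
qed

text \<open>For continuous \<open>a\<close> this is the fundamental theorem of calculus with equality.
  For merely integrable \<open>a\<close>, note that on a short interval \<open>[s,t]\<close> the integral is at
  most \<open>exp (A t) (A t - A s)\<close>, while \<open>exp (A t) - exp (A s) \<ge> exp (A s) (A t - A s)\<close>;
  the two bounds differ by the factor \<open>exp (A t - A s)\<close>, which is at most \<open>1 + e\<close> when
  the interval is short. The resulting inequality with the factor \<open>1 + e\<close> is additive
  over adjacent intervals, so the Bolzano principle extends it to \<open>[0,T]\<close>, and \<open>e\<close>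
  tends to \<open>0\<close>.\<close>

lemma integral_exp_primitive_le:
  fixes a :: "real \<Rightarrow> real"
  assumes a: "a integrable_on {0..T}" and nonneg: "\<And>s. s \<in> {0..T} \<Longrightarrow> 0 \<le> a s" and T: "0 \<le> T"
  defines "A \<equiv> \<lambda>t. integral {0..t} a"
  shows "integral {0..T} (\<lambda>s. a s * exp (A s)) \<le> exp (A T) - 1"
proof -
  have cont: "continuous_on {0..T} A"
    unfolding A_def by (rule indefinite_integral_continuous_1[OF a])
  have int: "(\<lambda>s. a s * exp (A s)) integrable_on {0..T}"
    by (rule set_lebesgue_integral_eq_integral(1),
        rule absolutely_integrable_mult_continuous)
       (use cont a nonneg in \<open>auto intro!: continuous_intros nonnegative_absolutely_integrable_1\<close>)
  have asub: "a integrable_on {s..t}" if "0 \<le> s" "t \<le> T" for s t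
    by (rule integrable_on_subinterval[OF a]) (use that in auto)
  have sub: "(\<lambda>s. a s * exp (A s)) integrable_on {s..t}" if "0 \<le> s" "t \<le> T" for s t
    by (rule integrable_on_subinterval[OF int]) (use that in auto)
  have incr: "integral {s..t} a = A t - A s" if "0 \<le> s" "s \<le> t" "t \<le> T" for s t
    using Henstock_Kurzweil_Integration.integral_combine[of 0 s t a] asub[of 0 t] that unfolding A_def by auto
  have mono: "A s \<le> A t" if "0 \<le> s" "s \<le> t" "t \<le> T" for s t
    using incr[OF that] Henstock_Kurzweil_Integration.integral_nonneg[OF asub[of s t]] nonneg that by fastforce
  have approx: "integral {0..T} (\<lambda>s. a s * exp (A s)) \<le> (1 + e) * (exp (A T) - exp (A 0))" if e: "e > 0" for e
  proof -
    \<comment> \<open>additive over adjacent intervals because the right-hand side telescopes\<close>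
    define P where "P s t \<longleftrightarrow> (0 \<le> s \<longrightarrow> s \<le> t \<longrightarrow> t \<le> T \<longrightarrow>
        integral {s..t} (\<lambda>s. a s * exp (A s)) \<le> (1 + e) * (exp (A t) - exp (A s)))" for s t
    have "P 0 T"
      using T
    proof (induction rule: Bolzano)
      case (trans s t u)
      then show ?case
        using Henstock_Kurzweil_Integration.integral_combine[of s t u "\<lambda>s. a s * exp (A s)"] sub[of s u] 
        by (auto simp: P_def algebra_simps)
    next
      case (local x)
      have "0 < ln (1 + e) / 2" using e by simp
      then obtain d where d: "d > 0" "\<And>y. y \<in> {0..T} \<Longrightarrow> dist y x < d \<Longrightarrow> dist (A y) (A x) < ln (1 + e) / 2"
        using cont local unfolding continuous_on_iff by (metis atLeastAtMost_iff)
      have "integral {s..t} (\<lambda>s. a s * exp (A s)) \<le> (1 + e) * (exp (A t) - exp (A s))"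
        if st: "s \<le> x" "x \<le> t" "t - s < d" "0 \<le> s" "t \<le> T" "s \<le> t" for s t
      proof -
        have le: "A t - A s \<le> ln (1 + e)"
        proof -
          have "\<bar>A s - A x\<bar> < ln (1 + e) / 2" "\<bar>A t - A x\<bar> < ln (1 + e) / 2"
            using d(2)[of s] d(2)[of t] st by (auto simp: dist_real_def)
          then show ?thesis by linarith
        qed
        have "integral {s..t} (\<lambda>s. a s * exp (A s)) \<le> integral {s..t} (\<lambda>r. a r * exp (A t))"
          by (intro integral_le sub integrable_on_mult_left asub mult_left_mono) (use st nonneg mono in auto)
        also have "\<dots> = (A t - A s) * exp (A t)"
          using incr[of s t] st by simp
        also have "\<dots> = exp (A t - A s) * (exp (A s) * (A t - A s))"
          by (simp add: exp_diff)
        also have "\<dots> \<le> (1 + e) * (exp (A s) * (A t - A s))"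
          using le e mono[of s t] st exp_le_cancel_iff[of "A t - A s" "ln (1 + e)"]
          by (intro mult_right_mono) auto
        also have "\<dots> \<le> (1 + e) * (exp (A s) * (exp (A t - A s) - 1))"
        proof -
          have "A t - A s \<le> exp (A t - A s) - 1"
            using exp_ge_add_one_self[of "A t - A s"] by linarith
          then show ?thesis using e by (intro mult_left_mono) auto
        qed
        also have "\<dots> = (1 + e) * (exp (A t) - exp (A s))"
          by (simp add: exp_diff algebra_simps)
        finally show ?thesis .
      qed
      then show ?case using d(1) unfolding P_def by blast
    qed
    then show ?thesis using T by (simp add: P_def)
  qed
  have A0: "A 0 = 0" by (simp add: A_def)
  have "((\<lambda>e. (1 + e) * (exp (A T) - exp (A 0))) \<longlongrightarrow> (1 + 0) * (exp (A T) - exp (A 0))) (at_right 0)"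
    by (intro tendsto_intros)
  then have "integral {0..T} (\<lambda>s. a s * exp (A s)) \<le> (1 + 0) * (exp (A T) - exp (A 0))"
    by (rule tendsto_lowerbound) (auto intro!: approx simp: eventually_at_right_less eventually_at intro!: exI[of _ 1])
  then show ?thesis by (simp add: A0)
qed

text \<open>A Gronwall estimate in weighted form: multiplication by \<open>a\<close> and integration maps
  the set of functions below \<open>d exp (c A)\<close> to the set of functions below
  \<open>d (exp (c A) - 1) / c\<close>. The case \<open>c = 1\<close> propagates an a priori bound exactly, and
  \<open>c = 2\<close> gains a factor \<open>1/2\<close>.\<close>

lemma integral_exp_majorant_le:
  fixes a \<phi> :: "real \<Rightarrow> real"
  assumes a: "a integrable_on {0..t}" and nonneg: "\<And>s. s \<in> {0..t} \<Longrightarrow> 0 \<le> a s" and t: "0 \<le> t"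
    and \<phi>: "continuous_on {0..t} \<phi>" "\<And>s. s \<in> {0..t} \<Longrightarrow> \<phi> s \<le> d * exp (c * integral {0..s} a)"
    and c: "c > 0" and d: "d \<ge> 0"
  shows "integral {0..t} (\<lambda>s. a s * \<phi> s) \<le> d * (exp (c * integral {0..t} a) - 1) / c"
proof -
  have abs: "a absolutely_integrable_on {0..t}"
    using a nonneg by (intro nonnegative_absolutely_integrable_1) auto
  have cont: "continuous_on {0..t} (\<lambda>s. integral {0..s} a)"
    by (rule indefinite_integral_continuous_1[OF a])
  have "integral {0..t} (\<lambda>s. a s * \<phi> s) \<le> integral {0..t} (\<lambda>s. a s * (d * exp (c * integral {0..s} a)))"
    by (intro integral_le set_lebesgue_integral_eq_integral(1) absolutely_integrable_mult_continuous
        abs mult_left_mono continuous_intros cont \<phi> nonneg)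
  also have "\<dots> = d / c * integral {0..t} (\<lambda>s. (c * a s) * exp (integral {0..s} (\<lambda>s. c * a s)))"
    using c by (subst integral_mult_right[symmetric]) (simp add: algebra_simps)
  also have "\<dots> \<le> d / c * (exp (integral {0..t} (\<lambda>s. c * a s)) - 1)"
    by (intro mult_left_mono integral_exp_primitive_le integrable_on_mult_right) (use assms in auto)
  finally show ?thesis by simp
qed

text \<open>After the substitution \<open>s \<mapsto> s + \<tau>\<close> the integral over \<open>[\<tau>,t]\<close> sees \<open>\<phi>\<close> only at
  nonnegative times, and the part over \<open>[0,\<tau>]\<close> sees only the history, where \<open>\<phi> \<le> h\<close>.\<close>

lemma integral_delay_le:
  fixes p \<phi> :: "real \<Rightarrow> real"
  assumes p: "p integrable_on {0..t + \<tau>}" "\<And>s. s \<ge> 0 \<Longrightarrow> 0 \<le> p s"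
    and t: "0 \<le> t" and \<tau>: "0 < \<tau>"
    and \<phi>: "continuous_on {-\<tau>..t} \<phi>" "\<And>s. 0 \<le> \<phi> s" "\<And>s. s \<in> {-\<tau>..0} \<Longrightarrow> \<phi> s \<le> h"
  shows "integral {0..t} (\<lambda>s. p s * \<phi> (s - \<tau>))
    \<le> h * integral {0..\<tau>} p + integral {0..t} (\<lambda>s. p (s + \<tau>) * \<phi> s)"
proof -
  have h: "0 \<le> h" using \<phi>(2,3)[of 0] \<tau> by auto
  have psub: "p integrable_on {x..y}" if "0 \<le> x" "y \<le> t + \<tau>" for x y
    by (rule integrable_on_subinterval[OF p(1)]) (use that in auto)
  have abs: "p absolutely_integrable_on {x..y}" if "0 \<le> x" "y \<le> t + \<tau>" for x y
    using psub[OF that] p(2) that by (intro nonnegative_absolutely_integrable_1) auto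
  have int: "(\<lambda>s. p s * \<phi> (s - \<tau>)) integrable_on {x..y}" if "0 \<le> x" "y \<le> t + \<tau>" for x y
    by (intro set_lebesgue_integral_eq_integral(1) absolutely_integrable_mult_continuous
        abs that continuous_on_compose2[OF \<phi>(1)] continuous_intros) (use that in auto)
  have int2: "(\<lambda>s. p (s + \<tau>) * \<phi> s) integrable_on {0..t}"
    using integrable_on_shift_Icc_real[of "\<lambda>s. p s * \<phi> (s - \<tau>)" \<tau> 0 t] int[of \<tau> "t + \<tau>"] \<tau>
    by (simp add: add.commute comp_def)
  have hist: "integral {0..y} (\<lambda>s. p s * \<phi> (s - \<tau>)) \<le> h * integral {0..\<tau>} p" if "0 \<le> y" "y \<le> \<tau>" for y
  proof -
    have "integral {0..y} (\<lambda>s. p s * \<phi> (s - \<tau>)) \<le> integral {0..y} (\<lambda>s. p s * h)"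
      by (intro integral_le int integrable_on_mult_left psub mult_left_mono p(2) \<phi>(3)) (use that t in auto)
    also have "\<dots> = h * integral {0..y} p" by simp
    also have "\<dots> \<le> h * integral {0..\<tau>} p"
      by (intro mult_left_mono integral_subset_le psub h) (use that t p(2) in auto)
    finally show ?thesis .
  qed
  have nn: "0 \<le> integral {0..t} (\<lambda>s. p (s + \<tau>) * \<phi> s)"
    by (intro Henstock_Kurzweil_Integration.integral_nonneg int2 mult_nonneg_nonneg p(2) \<phi>(2)) (use \<tau> in auto)
  show ?thesis
  proof (cases "t \<le> \<tau>")
    case True
    then show ?thesis using hist[OF t] nn by simp
  next
    case False
    have "integral {0..t} (\<lambda>s. p s * \<phi> (s - \<tau>)) =
      integral {0..\<tau>} (\<lambda>s. p s * \<phi> (s - \<tau>)) + integral {\<tau>..t} (\<lambda>s. p s * \<phi> (s - \<tau>))"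
      using False \<tau> by (intro Henstock_Kurzweil_Integration.integral_combine[symmetric] int) auto
    also have "integral {\<tau>..t} (\<lambda>s. p s * \<phi> (s - \<tau>)) = integral {0..t - \<tau>} (\<lambda>s. p (s + \<tau>) * \<phi> s)"
      using integral_shift_real_ivl[of "\<tau>" "\<tau>" t "\<lambda>s. p s * \<phi> (s - \<tau>)"] by simp
    also have "\<dots> \<le> integral {0..t} (\<lambda>s. p (s + \<tau>) * \<phi> s)"
      by (intro integral_subset_le int2 integrable_on_subinterval[OF int2] mult_nonneg_nonneg p(2) \<phi>(2)) (use \<tau> p(2) \<phi>(2) in auto)
    finally show ?thesis using hist[of \<tau>] \<tau> by simp
  qed
qed

lemma absolutely_integrable_on_iff_lebesgue_on:
  fixes f :: "real \<Rightarrow> real"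
  shows "f absolutely_integrable_on {c..d} \<longleftrightarrow> integrable (lebesgue_on {c..d}) f"
  by (simp add: set_integrable_def integrable_restrict_space)

lemma finite_measure_lebesgue_on_Icc: "finite_measure (lebesgue_on {a..b::real})"
  by (rule finite_measureI) (cases "a \<le> b"; simp add: emeasure_restrict_space)

lemma continuous_on_Ici_from_Icc:
  fixes f :: "real \<Rightarrow> 'a::topological_space"
  assumes "\<And>T. T \<ge> a \<Longrightarrow> continuous_on {a..T} f"
  shows "continuous_on {a..} f"
  unfolding continuous_on_eq_continuous_within
proof
  fix x assume "x \<in> {a..}"
  then have "continuous (at x within {a..x+1}) f"
    using assms[of "x+1"] unfolding continuous_on_eq_continuous_within by auto
  moreover have "at x within {a..x+1} = at x within {a..}"
    by (rule at_within_nhd[of _ "{..<x+1}"]) auto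
  ultimately show "continuous (at x within {a..}) f" by simp
qed

section \<open>Duhamel integrals for a semigroup\<close>

text \<open>The equation \<open>U' = \<Lambda>U + \<alpha>(t) B U(t - \<tau>) + F(U(t), U(t - \<tau>))\<close> in a Banach space,
  where the unbounded operator \<open>\<Lambda>\<close> enters only through its semigroup \<open>S\<close>. The map
  \<open>r \<mapsto> L r\<close> is any choice of Lipschitz constants on the balls of radius \<open>r\<close>.\<close>

locale delay_evolution =
  fixes S :: "real \<Rightarrow> 'x::{real_normed_vector, complete_space} \<Rightarrow> 'x"
    and \<alpha> :: "real \<Rightarrow> real" and B :: "'x \<Rightarrow> 'x" and F :: "'x \<Rightarrow> 'x \<Rightarrow> 'x"
    and L :: "real \<Rightarrow> real" and M \<omega> \<tau> b :: real
  assumes tau: "0 < \<tau>"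
    and semigroup: "C0_semigroup S"
    and M_nonneg: "0 \<le> M" and \<omega>_nonneg: "0 \<le> \<omega>"
    and decay: "\<And>t x. 0 \<le> t \<Longrightarrow> norm (S t x) \<le> M * exp (- \<omega> * t) * norm x"
    and \<alpha>_int: "\<And>T. 0 \<le> T \<Longrightarrow> integrable (lebesgue_on {0..T}) \<alpha>"
    and B_linear: "bounded_linear B"
    and B_bound: "\<And>X. norm (B X) \<le> b * norm X" and b_nonneg: "0 \<le> b"
    and L_nonneg: "\<And>r. 0 < r \<Longrightarrow> 0 \<le> L r"
    and F_lipschitz: "\<And>r X1 Y1 X2 Y2. 0 < r \<Longrightarrow> norm X1 \<le> r \<Longrightarrow> norm Y1 \<le> r \<Longrightarrow>
        norm X2 \<le> r \<Longrightarrow> norm Y2 \<le> r \<Longrightarrow>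
        norm (F X1 Y1 - F X2 Y2) \<le> L r * (norm (X1 - X2) + norm (Y1 - Y2))"
    and F_zero: "F 0 0 = 0"
begin

definition forcing :: "(real \<Rightarrow> 'x) \<Rightarrow> real \<Rightarrow> 'x" where
  "forcing U s = \<alpha> s *\<^sub>R B (U (s - \<tau>)) + F (U s) (U (s - \<tau>))"

definition duhamel :: "(real \<Rightarrow> 'x) \<Rightarrow> real \<Rightarrow> 'x \<Rightarrow> bool" where
  "duhamel f t I \<longleftrightarrow> bochner_has_integral (lebesgue_on {0..t}) (\<lambda>s. S (t - s) (f s)) I"

text \<open>The coefficient of \<open>\<phi>(s - \<tau>)\<close>, with \<open>\<phi>(s) = exp (\<omega> s) \<parallel>U s - V s\<parallel>\<close>, in the
  estimate of a difference of two Duhamel integrals on a ball where \<open>F\<close> has Lipschitz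
  constant \<open>l\<close>. The factor \<open>exp (\<omega> \<tau>)\<close> compensates for evaluating the weight at
  \<open>s - \<tau>\<close>.\<close>

definition delay_weight :: "real \<Rightarrow> real \<Rightarrow> real" where
  "delay_weight l s = M * b * exp (\<omega> * \<tau>) * \<bar>\<alpha> s\<bar> + M * l * exp (\<omega> * \<tau>)"

text \<open>The total coefficient of \<open>\<phi>(s)\<close> after the delayed terms have been shifted to the
  time at which \<open>\<phi>\<close> is evaluated.\<close>

definition rate :: "real \<Rightarrow> real \<Rightarrow> real" where
  "rate l s = delay_weight l (s + \<tau>) + M * l"

definition growth :: "real \<Rightarrow> real \<Rightarrow> real" where
  "growth l t = integral {0..t} (rate l)"

text \<open>The factor by which the size of the history on \<open>[-\<tau>,0]\<close> contributes to the
  Duhamel integral through the delayed terms.\<close>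

definition history_mass :: "real \<Rightarrow> real" where
  "history_mass l = integral {0..\<tau>} (delay_weight l)"

lemma S_linear: "0 \<le> t \<Longrightarrow> bounded_linear (S t)"
  and S_zero: "S 0 x = x"
  and S_add: "0 \<le> s \<Longrightarrow> 0 \<le> t \<Longrightarrow> S (s + t) x = S s (S t x)"
  and S_tendsto: "((\<lambda>t. S t x) \<longlongrightarrow> x) (at_right 0)"
  using semigroup unfolding C0_semigroup_def by auto

lemma S_bound: "0 \<le> t \<Longrightarrow> norm (S t x) \<le> M * norm x"
proof -
  assume t: "0 \<le> t"
  have "M * exp (- \<omega> * t) * norm x \<le> M * 1 * norm x"
    using M_nonneg \<omega>_nonneg t by (intro mult_right_mono mult_left_mono) auto
  then show ?thesis using decay[OF t, of x] by simp
qed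

text \<open>The semigroup law reduces the modulus of continuity of an orbit at any time to
  that at time \<open>0\<close>, from both sides.\<close>

lemma S_diff_bound:
  assumes "0 \<le> s" "0 \<le> t"
  shows "norm (S t x - S s x) \<le> M * norm (S \<bar>t - s\<bar> x - x)"
proof -
  have *: "norm (S t x - S s x) \<le> M * norm (S \<bar>t - s\<bar> x - x)" if "0 \<le> s" "s \<le> t" for s t
  proof -
    have "S t x - S s x = S s (S (t - s) x - x)"
      using S_add[of s "t - s" x] that by (simp add: linear_diff bounded_linear.linear[OF S_linear])
    then show ?thesis using S_bound[of s "S (t - s) x - x"] that by simp
  qed
  show ?thesis
    using *[of s t] *[of t s] assms by (cases "s \<le> t") (auto simp: norm_minus_commute abs_minus_commute)
qed

lemma orbit_continuous: "continuous_on {0..} (\<lambda>t. S t x)"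
  unfolding continuous_on_iff
proof (intro ballI allI impI)
  fix s e :: real assume s: "s \<in> {0..}" and e: "0 < e"
  have "\<forall>\<^sub>F h in at_right 0. dist (S h x) x < e / (M + 1)"
    using tendstoD[OF S_tendsto] e M_nonneg by simp
  then obtain d where d: "d > 0" "\<And>h. 0 < h \<Longrightarrow> h < d \<Longrightarrow> dist (S h x) x < e / (M + 1)"
    unfolding eventually_at_right_field by auto
  have "dist (S t x) (S s x) < e" if "t \<in> {0..}" "dist t s < d" for t
  proof -
    have "norm (S \<bar>t - s\<bar> x - x) < e / (M + 1)"
      using d(2)[of "\<bar>t - s\<bar>"] that e M_nonneg by (cases "t = s") (auto simp: dist_norm S_zero)
    then have "(M + 1) * norm (S \<bar>t - s\<bar> x - x) < e"
      using M_nonneg by (simp add: field_simps)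
    moreover have "norm (S t x - S s x) \<le> M * norm (S \<bar>t - s\<bar> x - x)"
      by (rule S_diff_bound) (use that s in auto)
    moreover have "0 \<le> norm (S \<bar>t - s\<bar> x - x)" by simp
    ultimately show ?thesis unfolding dist_norm distrib_right by linarith
  qed
  then show "\<exists>d>0. \<forall>t\<in>{0..}. dist t s < d \<longrightarrow> dist (S t x) (S s x) < e" using d(1) by blast
qed

lemma S_jointly_continuous:
  assumes c: "continuous_on D c" and r: "continuous_on D r" "\<And>s. s \<in> D \<Longrightarrow> 0 \<le> r s"
  shows "continuous_on D (\<lambda>s. S (r s) (c s))"
  unfolding continuous_on_def
proof
  fix s0 assume s0: "s0 \<in> D"
  have ev: "\<forall>\<^sub>F s in at s0 within D. s \<in> D" by (auto simp: eventually_at_filter)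
  have "continuous_on D (\<lambda>s. S (r s) (c s0))"
    by (rule continuous_on_compose2[OF orbit_continuous r(1)]) (use r(2) in auto)
  then have "((\<lambda>s. norm (S (r s) (c s0) - S (r s0) (c s0))) \<longlongrightarrow> norm (S (r s0) (c s0) - S (r s0) (c s0))) (at s0 within D)"
    using s0 unfolding continuous_on_def by (intro tendsto_intros) auto
  moreover have "((\<lambda>s. M * norm (c s - c s0)) \<longlongrightarrow> M * norm (c s0 - c s0)) (at s0 within D)"
    using c s0 unfolding continuous_on_def by (intro tendsto_intros) auto
  ultimately have "((\<lambda>s. M * norm (c s - c s0) + norm (S (r s) (c s0) - S (r s0) (c s0))) \<longlongrightarrow> 0) (at s0 within D)"
    by (auto intro: tendsto_add_zero)
  moreover have "\<forall>\<^sub>F s in at s0 within D. norm (S (r s) (c s) - S (r s0) (c s0))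
      \<le> M * norm (c s - c s0) + norm (S (r s) (c s0) - S (r s0) (c s0))"
    using ev
  proof eventually_elim
    case (elim s)
    have eq: "S (r s) (c s) - S (r s0) (c s0) = S (r s) (c s - c s0) + (S (r s) (c s0) - S (r s0) (c s0))"
      using r(2)[OF elim] by (simp add: linear_diff bounded_linear.linear[OF S_linear])
    show ?case
      unfolding eq using S_bound[OF r(2)[OF elim], of "c s - c s0"] norm_triangle_ineq[of "S (r s) (c s - c s0)" "S (r s) (c s0) - S (r s0) (c s0)"]
      by linarith
  qed
  ultimately have "((\<lambda>s. S (r s) (c s) - S (r s0) (c s0)) \<longlongrightarrow> 0) (at s0 within D)"
    by (rule Lim_null_comparison[rotated])
  then show "((\<lambda>s. S (r s) (c s)) \<longlongrightarrow> S (r s0) (c s0)) (at s0 within D)"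
    by (rule LIM_zero_cancel)
qed

lemma \<alpha>_abs_int: "0 \<le> c \<Longrightarrow> \<alpha> absolutely_integrable_on {c..d}"
  using \<alpha>_int[of "max c d"] unfolding absolutely_integrable_on_iff_lebesgue_on[symmetric]
  by (rule set_integrable_subset) auto

context
  fixes T :: real and c1 c2 f :: "real \<Rightarrow> 'x"
  assumes c1: "continuous_on {0..T} c1" and c2: "continuous_on {0..T} c2"
    and f: "\<And>s. f s = \<alpha> s *\<^sub>R c1 s + c2 s"
begin

lemma propagated_measurable:
  "strongly_measurable (lebesgue_on {0..T}) (\<lambda>s. S (max 0 (t - s)) (f s))"
proof -
  have 1: "strongly_measurable (lebesgue_on {0..T}) (\<lambda>s. S (max 0 (t - s)) (c s))" 
    if "continuous_on {0..T} c" for c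
    by (intro strongly_measurable_continuous_on S_jointly_continuous that continuous_intros) auto
  have 2: "strongly_measurable (lebesgue_on {0..T}) \<alpha>"
    by (cases "0 \<le> T")
       (auto intro!: strongly_measurable_real borel_measurable_integrable \<alpha>_int 
         simp: absolutely_integrable_on_iff_lebesgue_on[symmetric])
  have "S (max 0 (t - s)) (f s) = \<alpha> s *\<^sub>R S (max 0 (t - s)) (c1 s) + S (max 0 (t - s)) (c2 s)" for s
    by (simp add: f linear_add linear_scale bounded_linear.linear[OF S_linear])
  then show ?thesis
    by (simp add: strongly_measurable_add strongly_measurable_scaleR 1 2 c1 c2)
qed

lemma forcing_integrable: "integrable (lebesgue_on {0..T}) (\<lambda>s. \<bar>\<alpha> s\<bar> * norm (c1 s) + norm (c2 s))"
  unfolding absolutely_integrable_on_iff_lebesgue_on[symmetric]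
  by (intro set_integral_add(1) absolutely_integrable_mult_continuous set_integrable_abs \<alpha>_abs_int
      absolutely_integrable_continuous_real continuous_intros c1 c2) auto

lemma norm_propagated_le:
  assumes "0 \<le> r" shows "norm (S r (f s)) \<le> M * (\<bar>\<alpha> s\<bar> * norm (c1 s) + norm (c2 s))"
proof -
  have "norm (S r (f s)) \<le> M * norm (f s)" by (rule S_bound[OF assms])
  also have "\<dots> \<le> M * (\<bar>\<alpha> s\<bar> * norm (c1 s) + norm (c2 s))"
    using norm_triangle_ineq[of "\<alpha> s *\<^sub>R c1 s" "c2 s"] by (intro mult_left_mono M_nonneg) (simp add: f)
  finally show ?thesis .
qed

lemma duhamel_exists:
  assumes "T \<ge> 0" shows "\<exists>I. duhamel f T I"
proof -
  let ?N = "lebesgue_on {0..T}"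
  have complete: "complete_measure ?N" by (rule complete_measure_lebesgue_on) simp
  have "integrable ?N (\<lambda>s. norm (S (max 0 (T - s)) (f s)))"
  proof (rule Bochner_Integration.integrable_bound)
    show "integrable ?N (\<lambda>s. M * (\<bar>\<alpha> s\<bar> * norm (c1 s) + norm (c2 s)))"
      by (intro integrable_mult_right forcing_integrable)
    show "(\<lambda>s. norm (S (max 0 (T - s)) (f s))) \<in> borel_measurable ?N"
      by (rule strongly_measurable_norm[OF complete propagated_measurable])
    show "AE s in ?N. norm (norm (S (max 0 (T - s)) (f s))) \<le> norm (M * (\<bar>\<alpha> s\<bar> * norm (c1 s) + norm (c2 s)))"
    proof (rule AE_I2)
      fix s
      show "norm (norm (S (max 0 (T - s)) (f s))) \<le> norm (M * (\<bar>\<alpha> s\<bar> * norm (c1 s) + norm (c2 s)))"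
        using norm_propagated_le[of "max 0 (T - s)" s] by simp
    qed
  qed
  then obtain I where "bochner_has_integral ?N (\<lambda>s. S (max 0 (T - s)) (f s)) I"
    using bochner_has_integral_exists[OF complete finite_measure_lebesgue_on_Icc propagated_measurable] by auto
  then have "duhamel f T I"
    unfolding duhamel_def by (rule bochner_has_integral_cong[THEN iffD1, rotated]) simp
  then show ?thesis ..
qed

text \<open>All integrals are written over the fixed interval \<open>[0,T]\<close>, with an integrand
  that vanishes for \<open>s > t\<close>. The integrands then converge pointwise for \<open>s \<noteq> t\<close> and
  have the common majorant \<open>g\<close>, so the scalar dominated convergence theorem applies to
  the norms of their differences.\<close>

lemma duhamel_continuous:
  assumes J: "\<And>t. t \<in> {0..T} \<Longrightarrow> duhamel f t (J t)"
  shows "continuous_on {0..T} J"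
proof (cases "0 \<le> T")
  case True
  let ?N = "lebesgue_on {0..T}"
  have complete: "complete_measure ?N" by (rule complete_measure_lebesgue_on) simp
  define H where "H t s = indicator {0..t} s *\<^sub>R S (max 0 (t - s)) (f s)" for t s
  have H_int: "bochner_has_integral ?N (H t) (J t)" if t: "t \<in> {0..T}" for t
  proof -
    have sub: "{0..T} \<inter> {0..t} = {0..t}" using t by auto
    have "bochner_has_integral (restrict_space ?N {0..t}) (\<lambda>s. S (t - s) (f s)) (J t)"
      using J[OF t] unfolding duhamel_def using t by (simp add: restrict_restrict_space sub min_absorb2)
    then have "bochner_has_integral ?N (\<lambda>s. indicator {0..t} s *\<^sub>R S (t - s) (f s)) (J t)"
      by (rule bochner_has_integral_indicator[rotated]) (use t in \<open>auto simp: sets_restrict_space_iff\<close>)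
    moreover have "H t = (\<lambda>s. indicator {0..t} s *\<^sub>R S (t - s) (f s))"
      by (rule ext) (auto simp: H_def indicator_def)
    ultimately show ?thesis by simp
  qed
  have H_meas: "strongly_measurable ?N (H t)" if "t \<in> {0..T}" for t
    using H_int[OF that] unfolding bochner_has_integral_def by blast
  define g where "g s = M * (\<bar>\<alpha> s\<bar> * norm (c1 s) + norm (c2 s))" for s
  have H_bound: "norm (H t s) \<le> g s" for t s
  proof -
    have "norm (H t s) \<le> norm (S (max 0 (t - s)) (f s))" by (simp add: H_def indicator_def)
    then show ?thesis using norm_propagated_le[of "max 0 (t - s)" s] by (simp add: g_def)
  qed
  have g_int: "integrable ?N g"
    unfolding g_def by (intro integrable_mult_right forcing_integrable)
  have diff_int: "integrable ?N (\<lambda>s. norm (H t' s - H t s))" 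
    and diff_meas: "(\<lambda>s. norm (H t' s - H t s)) \<in> borel_measurable ?N"
    and diff_bound: "norm (H t' s - H t s) \<le> 2 * g s"
    if "t \<in> {0..T}" "t' \<in> {0..T}" for t t' s
  proof -
    show le: "norm (H t' s - H t s) \<le> 2 * g s" for s
      using norm_triangle_ineq4[of "H t' s" "H t s"] H_bound[of t' s] H_bound[of t s] by linarith
    show meas: "(\<lambda>s. norm (H t' s - H t s)) \<in> borel_measurable ?N"
      by (intro strongly_measurable_norm[OF complete] strongly_measurable_diff H_meas that)
    show "integrable ?N (\<lambda>s. norm (H t' s - H t s))"
    proof (rule Bochner_Integration.integrable_bound[OF integrable_mult_right[OF g_int, of 2] meas], rule AE_I2)
      fix s show "norm (norm (H t' s - H t s)) \<le> norm (2 * g s)" using le[of s] by simp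
    qed
  qed
  show ?thesis
    unfolding continuous_on_sequentially
  proof (intro allI ballI impI, elim conjE)
    fix x t assume t: "t \<in> {0..T}" and x: "\<forall>n. x n \<in> {0..T}" and lim: "x \<longlonglongrightarrow> t"
    have pointwise: "(\<lambda>n. norm (H (x n) s - H t s)) \<longlonglongrightarrow> 0" if s: "s \<in> {0..T}" "s \<noteq> t" for s
    proof (cases "s < t")
      case True
      have "\<forall>\<^sub>F n in sequentially. s < x n" using order_tendstoD(1)[OF lim True] .
      then have eq: "\<forall>\<^sub>F n in sequentially. S (max 0 (x n - s)) (f s) = H (x n) s"
        by eventually_elim (use s in \<open>auto simp: H_def\<close>)
      have "(\<lambda>n. S (max 0 (x n - s)) (f s)) \<longlonglongrightarrow> S (max 0 (t - s)) (f s)"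
        by (rule continuous_on_tendsto_compose[OF orbit_continuous]) (auto intro!: tendsto_intros lim)
      from Lim_transform_eventually[OF this eq] have "(\<lambda>n. H (x n) s) \<longlonglongrightarrow> H t s"
        using True s by (simp add: H_def)
      then show ?thesis by (intro tendsto_norm_zero LIM_zero)
    next
      case False
      then have "\<forall>\<^sub>F n in sequentially. x n < s" using order_tendstoD(2)[OF lim, of s] s by auto
      then have "\<forall>\<^sub>F n in sequentially. 0 = norm (H (x n) s - H t s)"
        by eventually_elim (use False s in \<open>auto simp: H_def\<close>)
      then show ?thesis by (rule Lim_transform_eventually[OF tendsto_const])
    qed
    have "(\<lambda>n. LINT s|?N. norm (H (x n) s - H t s)) \<longlonglongrightarrow> (LINT s|?N. 0)"
    proof (rule integral_dominated_convergence)
      show "integrable ?N (\<lambda>s. 2 * g s)" by (intro integrable_mult_right g_int)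
      have "AE s in lebesgue. s \<noteq> t" by (simp add: AE_completion AE_lborel_singleton)
      then show "AE s in ?N. (\<lambda>n. norm (H (x n) s - H t s)) \<longlonglongrightarrow> 0"
        by (subst AE_restrict_space_iff) (auto elim!: eventually_mono intro: pointwise)
      show "AE s in ?N. norm (norm (H (x n) s - H t s)) \<le> 2 * g s" for n
        using diff_bound[OF t] x by (intro AE_I2) simp
    qed (use diff_meas[OF t] x in auto)
    then have "(\<lambda>n. LINT s|?N. norm (H (x n) s - H t s)) \<longlonglongrightarrow> 0" by simp
    moreover have "norm (J (x n) - J t) \<le> (LINT s|?N. norm (H (x n) s - H t s))" for n
      using x t by (intro norm_bochner_integral_le[OF complete bochner_has_integral_diff[OF complete H_int H_int]] diff_int) auto
    ultimately have "(\<lambda>n. J (x n) - J t) \<longlonglongrightarrow> 0"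
      by (intro Lim_null_comparison[of "\<lambda>n. J (x n) - J t"]) auto
    then show "(J \<circ> x) \<longlonglongrightarrow> J t" unfolding comp_def by (rule LIM_zero_cancel)
  qed
qed simp

end

section \<open>The weighted difference estimate and uniqueness\<close>

lemma delay_weight_nonneg: "0 \<le> l \<Longrightarrow> 0 \<le> delay_weight l s"
  unfolding delay_weight_def using M_nonneg b_nonneg by simp

lemma rate_nonneg: "0 \<le> l \<Longrightarrow> 0 \<le> rate l s"
  unfolding rate_def using delay_weight_nonneg M_nonneg by simp

lemma delay_weight_abs_int: "0 \<le> c \<Longrightarrow> delay_weight l absolutely_integrable_on {c..d}"
  unfolding delay_weight_def
  by (intro set_integral_add(1) set_integrable_mult_right set_integrable_abs \<alpha>_abs_int
      absolutely_integrable_continuous_real continuous_intros)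

lemma delay_weight_int: "0 \<le> c \<Longrightarrow> delay_weight l integrable_on {c..d}"
  by (intro set_lebesgue_integral_eq_integral(1) delay_weight_abs_int)

lemma delay_weight_shift_int: "(\<lambda>s. delay_weight l (s + \<tau>)) integrable_on {0..t}"
  using integrable_on_shift_Icc_real[of "delay_weight l" \<tau> 0 t] delay_weight_int[of \<tau> l "\<tau> + t"] tau
  by (simp add: add.commute comp_def)

lemma rate_int: "rate l integrable_on {0..t}"
  unfolding rate_def by (intro integrable_add delay_weight_shift_int integrable_continuous_interval continuous_intros)

lemma growth_continuous: "continuous_on {0..} (growth l)"
  unfolding growth_def
  by (intro continuous_on_Ici_from_Icc indefinite_integral_continuous_1 rate_int)

lemma growth_zero: "growth l 0 = 0" by (simp add: growth_def)

lemma growth_nonneg: "0 \<le> l \<Longrightarrow> 0 \<le> growth l t"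
  unfolding growth_def by (intro Henstock_Kurzweil_Integration.integral_nonneg rate_int rate_nonneg)

lemma forcing_components_continuous:
  assumes U: "continuous_on {-\<tau>..T} U"
  shows "continuous_on {0..T} (\<lambda>s. B (U (s - \<tau>)))"
    and "continuous_on {0..T} (\<lambda>s. F (U s) (U (s - \<tau>)))"
proof -
  have Us: "continuous_on {0..T} U"
    by (rule continuous_on_subset[OF U]) (use tau in auto)
  have Ud: "continuous_on {0..T} (\<lambda>s. U (s - \<tau>))"
    by (rule continuous_on_compose2[OF U]) (auto intro!: continuous_intros simp: tau less_imp_le)
  show "continuous_on {0..T} (\<lambda>s. B (U (s - \<tau>)))"
    by (rule bounded_linear.continuous_on[OF B_linear Ud])
  have "bounded (U ` {-\<tau>..T})"
    by (intro compact_imp_bounded compact_continuous_image U) auto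
  then obtain r where r: "r > 0" "\<And>s. s \<in> {-\<tau>..T} \<Longrightarrow> norm (U s) \<le> r"
    unfolding bounded_pos by auto
  show "continuous_on {0..T} (\<lambda>s. F (U s) (U (s - \<tau>)))"
    unfolding continuous_on_def
  proof
    fix s0 assume s0: "s0 \<in> {0..T}"
    have "((\<lambda>s. L r * (norm (U s - U s0) + norm (U (s - \<tau>) - U (s0 - \<tau>)))) \<longlongrightarrow>
        L r * (norm (U s0 - U s0) + norm (U (s0 - \<tau>) - U (s0 - \<tau>)))) (at s0 within {0..T})"
      using Us Ud s0 unfolding continuous_on_def by (intro tendsto_intros) auto
    then have lim: "((\<lambda>s. L r * (norm (U s - U s0) + norm (U (s - \<tau>) - U (s0 - \<tau>)))) \<longlongrightarrow> 0) (at s0 within {0..T})"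
      by simp
    have "\<forall>\<^sub>F s in at s0 within {0..T}. s \<in> {0..T}" by (auto simp: eventually_at_filter)
    then have "\<forall>\<^sub>F s in at s0 within {0..T}. norm (F (U s) (U (s - \<tau>)) - F (U s0) (U (s0 - \<tau>)))
       \<le> L r * (norm (U s - U s0) + norm (U (s - \<tau>) - U (s0 - \<tau>)))"
      by eventually_elim (intro F_lipschitz r, use s0 tau in auto)
    from Lim_null_comparison[OF this lim]
    show "((\<lambda>s. F (U s) (U (s - \<tau>))) \<longlongrightarrow> F (U s0) (U (s0 - \<tau>))) (at s0 within {0..T})"
      by (rule LIM_zero_cancel)
  qed
qed

lemma duhamel_forcing_exists:
  assumes "continuous_on {-\<tau>..t} U" "0 \<le> t"
  shows "\<exists>I. duhamel (forcing U) t I"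
  by (rule duhamel_exists[OF forcing_components_continuous[OF assms(1)] _ assms(2)]) (simp add: forcing_def)

lemma duhamel_forcing_continuous:
  assumes "continuous_on {-\<tau>..T} U" "\<And>t. t \<in> {0..T} \<Longrightarrow> duhamel (forcing U) t (J t)"
  shows "continuous_on {0..T} J"
  by (rule duhamel_continuous[OF forcing_components_continuous[OF assms(1)] _ assms(2)]) (simp add: forcing_def)

lemma forcing_zero: "forcing (\<lambda>_. 0) s = 0"
  by (simp add: forcing_def F_zero linear_0 bounded_linear.linear[OF B_linear])

lemma duhamel_forcing_zero: "0 \<le> t \<Longrightarrow> duhamel (forcing (\<lambda>_. 0)) t 0"
proof -
  assume t: "0 \<le> t"
  obtain I where I: "duhamel (forcing (\<lambda>_. 0)) t I"
    using duhamel_forcing_exists[of t "\<lambda>_. 0"] t by auto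
  have "norm I \<le> (LINT s|lebesgue_on {0..t}. 0)"
    by (rule norm_bochner_integral_le[OF complete_measure_lebesgue_on I[unfolded duhamel_def]])
       (auto simp: forcing_zero linear_0 bounded_linear.linear[OF S_linear])
  then show ?thesis using I by simp
qed

text \<open>The decay of \<open>S (t - s)\<close> is absorbed by the weight: \<open>exp (\<omega> t)\<close> times
  \<open>exp (- \<omega> (t - s))\<close> is \<open>exp (\<omega> s)\<close>, which turns every norm on the right into a value
  of \<open>\<phi>\<close>. This leaves \<open>\<integral> (delay_weight s \<phi>(s - \<tau>) + M (L r) \<phi>(s)) ds\<close>, and the delayed
  part is shifted by \<open>integral_delay_le\<close>.\<close>

lemma duhamel_difference_le:
  fixes U V :: "real \<Rightarrow> 'x"
  defines "\<phi> \<equiv> \<lambda>s. exp (\<omega> * s) * norm (U s - V s)"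
  assumes t: "0 \<le> t" and r: "0 < r"
    and U: "continuous_on {-\<tau>..t} U" "\<And>s. s \<in> {-\<tau>..t} \<Longrightarrow> norm (U s) \<le> r"
    and V: "continuous_on {-\<tau>..t} V" "\<And>s. s \<in> {-\<tau>..t} \<Longrightarrow> norm (V s) \<le> r"
    and I: "duhamel (forcing U) t I" and J: "duhamel (forcing V) t J"
    and h: "\<And>s. s \<in> {-\<tau>..0} \<Longrightarrow> \<phi> s \<le> h"
  shows "exp (\<omega> * t) * norm (I - J) \<le> h * history_mass (L r) + integral {0..t} (\<lambda>s. rate (L r) s * \<phi> s)"
proof -
  have \<phi>_cont: "continuous_on {-\<tau>..t} \<phi>"
    unfolding \<phi>_def by (intro continuous_intros U V)
  have \<phi>_nonneg: "0 \<le> \<phi> s" for s by (simp add: \<phi>_def)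
  have \<phi>_now: "continuous_on {0..t} \<phi>"
    by (rule continuous_on_subset[OF \<phi>_cont]) (use tau in auto)
  have \<phi>_past: "continuous_on {0..t} (\<lambda>s. \<phi> (s - \<tau>))"
    by (rule continuous_on_compose2[OF \<phi>_cont]) (auto intro!: continuous_intros simp: tau less_imp_le)
  let ?p = "delay_weight (L r)"
  define g where "g s = ?p s * \<phi> (s - \<tau>) + M * L r * \<phi> s" for s
  have delay_abs: "(\<lambda>s. ?p s * \<phi> (s - \<tau>)) absolutely_integrable_on {0..t}"
    by (intro absolutely_integrable_mult_continuous delay_weight_abs_int \<phi>_past) auto
  have now_abs: "(\<lambda>s. M * L r * \<phi> s) absolutely_integrable_on {0..t}"
    by (intro absolutely_integrable_continuous_real continuous_intros \<phi>_now)
  have g_abs: "g absolutely_integrable_on {0..t}"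
    unfolding g_def by (intro set_integral_add(1) delay_abs now_abs)
  have bound: "norm (S (t - s) (forcing U s) - S (t - s) (forcing V s)) \<le> exp (- \<omega> * t) * g s"
    if s: "s \<in> {0..t}" for s
  proof -
    have "forcing U s - forcing V s = \<alpha> s *\<^sub>R B (U (s - \<tau>) - V (s - \<tau>))
        + (F (U s) (U (s - \<tau>)) - F (V s) (V (s - \<tau>)))"
      by (simp add: forcing_def linear_diff bounded_linear.linear[OF B_linear] algebra_simps)
    then have "norm (forcing U s - forcing V s) \<le> norm (\<alpha> s *\<^sub>R B (U (s - \<tau>) - V (s - \<tau>)))
        + norm (F (U s) (U (s - \<tau>)) - F (V s) (V (s - \<tau>)))"
      using norm_triangle_ineq by metis
    also have "\<dots> \<le> \<bar>\<alpha> s\<bar> * (b * norm (U (s - \<tau>) - V (s - \<tau>)))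
        + L r * (norm (U s - V s) + norm (U (s - \<tau>) - V (s - \<tau>)))"
      by (intro add_mono F_lipschitz r) (use s tau U V B_bound in \<open>auto intro!: mult_left_mono\<close>)
    finally have f: "norm (forcing U s - forcing V s) \<le> \<bar>\<alpha> s\<bar> * (b * norm (U (s - \<tau>) - V (s - \<tau>)))
        + L r * (norm (U s - V s) + norm (U (s - \<tau>) - V (s - \<tau>)))" .
    have "norm (S (t - s) (forcing U s) - S (t - s) (forcing V s)) = norm (S (t - s) (forcing U s - forcing V s))"
      using s by (simp add: linear_diff bounded_linear.linear[OF S_linear])
    also have "\<dots> \<le> M * exp (- \<omega> * (t - s)) * norm (forcing U s - forcing V s)"
      using s by (intro decay) auto
    also have "\<dots> \<le> M * exp (- \<omega> * (t - s)) * (\<bar>\<alpha> s\<bar> * (b * norm (U (s - \<tau>) - V (s - \<tau>)))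
        + L r * (norm (U s - V s) + norm (U (s - \<tau>) - V (s - \<tau>))))"
      using M_nonneg by (intro mult_left_mono f) auto
    also have "exp (- \<omega> * (t - s)) = exp (- \<omega> * t) * exp (\<omega> * s)"
      by (simp flip: exp_add add: algebra_simps)
    also have "M * (exp (- \<omega> * t) * exp (\<omega> * s)) * (\<bar>\<alpha> s\<bar> * (b * norm (U (s - \<tau>) - V (s - \<tau>)))
        + L r * (norm (U s - V s) + norm (U (s - \<tau>) - V (s - \<tau>)))) = exp (- \<omega> * t) * g s"
    proof -
      have e: "exp (\<omega> * s) = exp (\<omega> * \<tau>) * exp (\<omega> * (s - \<tau>))"
        by (simp flip: exp_add add: algebra_simps)
      have "exp (\<omega> * s) * norm (U (s - \<tau>) - V (s - \<tau>)) = exp (\<omega> * \<tau>) * \<phi> (s - \<tau>)"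
        unfolding \<phi>_def by (subst e) simp
      moreover have "exp (\<omega> * s) * norm (U s - V s) = \<phi> s" by (simp add: \<phi>_def)
      moreover have "M * (exp (- \<omega> * t) * exp (\<omega> * s)) * (\<bar>\<alpha> s\<bar> * (b * norm (U (s - \<tau>) - V (s - \<tau>)))
          + L r * (norm (U s - V s) + norm (U (s - \<tau>) - V (s - \<tau>))))
        = exp (- \<omega> * t) * (M * b * \<bar>\<alpha> s\<bar> * (exp (\<omega> * s) * norm (U (s - \<tau>) - V (s - \<tau>)))
          + M * L r * (exp (\<omega> * s) * norm (U s - V s))
          + M * L r * (exp (\<omega> * s) * norm (U (s - \<tau>) - V (s - \<tau>))))"
        by (simp add: algebra_simps)
      ultimately show ?thesis
        by (simp add: g_def delay_weight_def algebra_simps)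
    qed
    finally show ?thesis .
  qed
  have "bochner_has_integral (lebesgue_on {0..t}) (\<lambda>s. S (t - s) (forcing U s) - S (t - s) (forcing V s)) (I - J)"
    using I J unfolding duhamel_def by (intro bochner_has_integral_diff complete_measure_lebesgue_on) auto
  then have "norm (I - J) \<le> (LINT s|lebesgue_on {0..t}. exp (- \<omega> * t) * g s)"
    using g_abs unfolding absolutely_integrable_on_iff_lebesgue_on
    by (intro norm_bochner_integral_le complete_measure_lebesgue_on integrable_mult_right) (auto intro: bound[simplified])
  also have "\<dots> = exp (- \<omega> * t) * integral {0..t} g"
    using g_abs unfolding absolutely_integrable_on_iff_lebesgue_on
    by (simp add: lebesgue_integral_eq_integral)
  finally have "exp (\<omega> * t) * norm (I - J) \<le> exp (\<omega> * t) * (exp (- \<omega> * t) * integral {0..t} g)"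
    by (intro mult_left_mono) auto
  also have "\<dots> = integral {0..t} g" by (simp flip: exp_add mult.assoc)
  also have "\<dots> = integral {0..t} (\<lambda>s. ?p s * \<phi> (s - \<tau>)) + integral {0..t} (\<lambda>s. M * L r * \<phi> s)"
    unfolding g_def by (intro integral_add set_lebesgue_integral_eq_integral(1) delay_abs now_abs)
  also have "\<dots> \<le> (h * history_mass (L r) + integral {0..t} (\<lambda>s. ?p (s + \<tau>) * \<phi> s)) + integral {0..t} (\<lambda>s. M * L r * \<phi> s)"
    unfolding history_mass_def
    by (intro add_right_mono integral_delay_le delay_weight_int delay_weight_nonneg L_nonneg r t tau \<phi>_cont \<phi>_nonneg h) auto
  also have "\<dots> = h * history_mass (L r) + integral {0..t} (\<lambda>s. rate (L r) s * \<phi> s)"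
  proof -
    have "(\<lambda>s. ?p (s + \<tau>)) absolutely_integrable_on {0..t}"
      by (intro nonnegative_absolutely_integrable_1 delay_weight_shift_int delay_weight_nonneg L_nonneg r)
    then have "integral {0..t} (\<lambda>s. ?p (s + \<tau>) * \<phi> s) + integral {0..t} (\<lambda>s. M * L r * \<phi> s)
        = integral {0..t} (\<lambda>s. ?p (s + \<tau>) * \<phi> s + M * L r * \<phi> s)"
      by (intro integral_add[symmetric] set_lebesgue_integral_eq_integral(1) absolutely_integrable_mult_continuous now_abs \<phi>_now)
    then show ?thesis by (simp add: rate_def algebra_simps)
  qed
  finally show ?thesis .
qed

lemma mild_solution_iff:
  "mild_solution \<tau> S \<alpha> B F \<Phi> U \<longleftrightarrow> continuous_on {-\<tau>..} U \<and> (\<forall>t\<in>{-\<tau>..0}. U t = \<Phi> t) \<and>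
     (\<forall>t\<ge>0. \<exists>I. duhamel (forcing U) t I \<and> U t = S t (\<Phi> 0) + I)"
  unfolding mild_solution_def duhamel_def forcing_def ..

text \<open>On \<open>[-\<tau>,T]\<close> both solutions stay in some ball, so \<open>\<phi>\<close> satisfies
  \<open>\<phi>(t) \<le> \<integral>\<^sub>0\<^sup>t rate \<phi>\<close>. If \<open>m\<close> is the maximum of \<open>exp (- 2 A) \<phi>\<close>, then
  \<open>\<phi> \<le> m exp (2 A)\<close>, and at the point where the maximum is attained the majorant lemma
  gives \<open>m exp (2 A) \<le> m (exp (2 A) - 1) / 2\<close>, which forces \<open>m = 0\<close>.\<close>

theorem mild_solution_unique:
  assumes U: "mild_solution \<tau> S \<alpha> B F \<Phi> U" and V: "mild_solution \<tau> S \<alpha> B F \<Phi> V" and T: "-\<tau> \<le> T"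
  shows "V T = U T"
proof (cases "T \<le> 0")
  case True
  then show ?thesis using U V T unfolding mild_solution_def by simp
next
  case False
  have cont: "continuous_on {-\<tau>..T} U" "continuous_on {-\<tau>..T} V"
    using U V unfolding mild_solution_def by (auto intro: continuous_on_subset)
  have "bounded (U ` {-\<tau>..T} \<union> V ` {-\<tau>..T})"
    by (intro bounded_Un[THEN iffD2] conjI compact_imp_bounded compact_continuous_image cont) auto
  then obtain r where r: "r > 0" "\<And>s. s \<in> {-\<tau>..T} \<Longrightarrow> norm (U s) \<le> r" "\<And>s. s \<in> {-\<tau>..T} \<Longrightarrow> norm (V s) \<le> r"
    unfolding bounded_pos by auto
  define A where "A = growth (L r)"
  define \<phi> where "\<phi> s = exp (\<omega> * s) * norm (U s - V s)" for s
  have L0: "0 \<le> L r" by (rule L_nonneg[OF r(1)])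
  have \<phi>_cont: "continuous_on {0..T} \<phi>"
    unfolding \<phi>_def by (intro continuous_intros continuous_on_subset[OF cont(1)] continuous_on_subset[OF cont(2)])
       (use tau in auto)
  have volterra: "\<phi> t \<le> integral {0..t} (\<lambda>s. rate (L r) s * \<phi> s)" if t: "t \<in> {0..T}" for t
  proof -
    obtain I where I: "duhamel (forcing U) t I" "U t = S t (\<Phi> 0) + I"
      using U t unfolding mild_solution_iff by auto
    obtain J where J: "duhamel (forcing V) t J" "V t = S t (\<Phi> 0) + J"
      using V t unfolding mild_solution_iff by auto
    have "exp (\<omega> * t) * norm (I - J) \<le> 0 * history_mass (L r) + integral {0..t} (\<lambda>s. rate (L r) s * \<phi> s)"
      unfolding \<phi>_def
    proof (rule duhamel_difference_le[OF _ r(1) _ _ _ _ I(1) J(1)])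
      show "exp (\<omega> * s) * norm (U s - V s) \<le> 0" if "s \<in> {-\<tau>..0}" for s
        using U V that unfolding mild_solution_def by simp
    qed (use t r continuous_on_subset[OF cont(1)] continuous_on_subset[OF cont(2)] in auto)
    then show ?thesis using I(2) J(2) by (simp add: \<phi>_def)
  qed
  have A_cont: "continuous_on {0..T} A"
    unfolding A_def by (rule continuous_on_subset[OF growth_continuous]) auto
  obtain q where q: "q \<in> {0..T}" "\<And>s. s \<in> {0..T} \<Longrightarrow> exp (- 2 * A s) * \<phi> s \<le> exp (- 2 * A q) * \<phi> q"
  proof -
    have "continuous_on {0..T} (\<lambda>s. exp (- 2 * A s) * \<phi> s)"
      by (intro continuous_intros A_cont \<phi>_cont)
    then show ?thesis
      using that continuous_attains_sup[of "{0..T}" "\<lambda>s. exp (- 2 * A s) * \<phi> s"] False by auto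
  qed
  \<comment> \<open>the weighted maximum, which is attained by compactness\<close>
  define m where "m = exp (- 2 * A q) * \<phi> q"
  have m0: "0 \<le> m" by (simp add: m_def \<phi>_def)
  have \<phi>_le: "\<phi> s \<le> m * exp (2 * A s)" if "s \<in> {0..T}" for s
    using q(2)[OF that] by (simp add: m_def exp_minus field_simps)
  have "\<phi> q \<le> m * (exp (2 * A q) - 1) / 2"
    unfolding A_def growth_def
    by (rule order_trans[OF volterra[OF q(1)] integral_exp_majorant_le])
       (use q(1) m0 L0 \<phi>_le rate_nonneg in \<open>auto simp: A_def growth_def intro!: rate_int continuous_on_subset[OF \<phi>_cont]\<close>)
  moreover have "\<phi> q = m * exp (2 * A q)" by (simp add: m_def exp_minus)
  ultimately have "m * (exp (2 * A q) + 1) \<le> 0" by (simp add: algebra_simps)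
  then have "m = 0" using m0 by (simp add: mult_le_0_iff add_pos_pos not_le) (smt (verit) exp_gt_zero)
  then have "\<phi> T \<le> 0" using \<phi>_le[of T] False by simp
  then show ?thesis by (simp add: \<phi>_def mult_le_0_iff)
qed

section \<open>Global bounded solutions from small histories\<close>

text \<open>The contraction principle is applied to \<open>u = U / w\<close> with \<open>w = exp (2 A - \<omega> t)\<close>,
  in the space of bounded continuous functions. The history is prescribed through
  \<open>ext\<close>, so that only the values of \<open>u\<close> at nonnegative times matter. On the set \<open>X\<close>,
  which says \<open>\<parallel>U t\<parallel> \<le> K exp (A t - \<omega> t)\<close>, the last assumption keeps \<open>U\<close> in the ball of
  radius \<open>C\<close>, on which \<open>L C\<close> is a Lipschitz constant.\<close>

theorem mild_solution_exists_bounded: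
  assumes \<Phi>: "continuous_on {-\<tau>..0} \<Phi>" "\<And>s. s \<in> {-\<tau>..0} \<Longrightarrow> norm (\<Phi> s) \<le> \<rho>"
    and C: "0 < C" and \<rho>C: "\<rho> \<le> C"
    and small: "\<And>t. 0 \<le> t \<Longrightarrow> \<rho> * (M + history_mass (L C)) * exp (growth (L C) t - \<omega> * t) \<le> C"
  shows "\<exists>U. mild_solution \<tau> S \<alpha> B F \<Phi> U \<and> (\<forall>t\<ge>0. norm (U t) \<le> C)"
proof -
  define K where "K = \<rho> * (M + history_mass (L C))"
  define A where "A = growth (L C)"
  define w where "w t = exp (2 * A t - \<omega> * t)" for t
  define ext where "ext u s = (if s \<le> 0 then \<Phi> s else w s *\<^sub>R apply_bcontfun u s)" for u s
  define X where "X = PiC {0..} (\<lambda>t. cball 0 (K * exp (- A t)) \<inter> (if t = 0 then {\<Phi> 0} else UNIV))"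
  have L0: "0 \<le> L C" by (rule L_nonneg[OF C])
  have A_cont: "continuous_on {0..} A" and A_zero: "A 0 = 0" and A_nonneg: "\<And>t. 0 \<le> A t"
    unfolding A_def by (rule growth_continuous growth_zero growth_nonneg[OF L0])+
  have w_cont: "continuous_on {0..} w" and w_pos: "\<And>t. 0 < w t" and w_zero: "w 0 = 1"
    unfolding w_def by (auto intro!: continuous_intros A_cont simp: A_zero)
  have w_inverse: "1 / w t = exp (- 2 * A t) * exp (\<omega> * t)" for t
    by (simp add: w_def exp_diff exp_minus field_simps)
  have \<rho>0: "0 \<le> \<rho>" using order_trans[OF norm_ge_zero \<Phi>(2)[of 0]] tau by simp
  have hm0: "0 \<le> history_mass (L C)"
    unfolding history_mass_def
    by (intro Henstock_Kurzweil_Integration.integral_nonneg delay_weight_int delay_weight_nonneg L0) auto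
  \<comment> \<open>this uses \<open>S 0 = id\<close>: the bound at time \<open>0\<close> makes \<open>M\<close> at least \<open>1\<close> unless \<open>\<Phi> 0 = 0\<close>\<close>
  have \<Phi>0_M: "norm (\<Phi> 0) \<le> M * \<rho>"
    using S_bound[of 0 "\<Phi> 0"] \<Phi>(2)[of 0] tau M_nonneg mult_left_mono[of "norm (\<Phi> 0)" \<rho> M] by (simp add: S_zero)
  have \<Phi>0_K: "norm (\<Phi> 0) \<le> K"
    using \<Phi>0_M mult_nonneg_nonneg[OF \<rho>0 hm0] by (simp add: K_def algebra_simps)
  have K0: "0 \<le> K" unfolding K_def using \<rho>0 M_nonneg hm0 by simp
  have X_iff: "u \<in> X \<longleftrightarrow> apply_bcontfun u 0 = \<Phi> 0 \<and> (\<forall>t\<ge>0. norm (apply_bcontfun u t) \<le> K * exp (- A t))" for u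
    unfolding X_def mem_PiC_iff by (auto simp: Pi_iff)
  have ext_now: "ext u t = w t *\<^sub>R apply_bcontfun u t" if "u \<in> X" "0 \<le> t" for u t
    using that by (auto simp: ext_def X_iff w_zero)
  have ext_past: "ext u s = \<Phi> s" if "s \<le> 0" for u s using that by (simp add: ext_def)
  have ext_growth: "exp (\<omega> * t) * norm (ext u t) \<le> K * exp (A t)" if "u \<in> X" "0 \<le> t" for u t
  proof -
    have "exp (\<omega> * t) * norm (ext u t) \<le> exp (\<omega> * t) * (w t * (K * exp (- A t)))"
      using that w_pos[of t] by (auto simp: ext_now X_iff intro!: mult_left_mono)
    also have "\<dots> = K * exp (A t)"
      by (simp add: w_def exp_diff exp_minus mult_exp_exp field_simps flip: exp_add)
    finally show ?thesis .
  qed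
  have ext_bound: "norm (ext u s) \<le> C" if "u \<in> X" "s \<in> {-\<tau>..}" for u s
  proof (cases "s \<le> 0")
    case True
    then show ?thesis using \<Phi>(2)[of s] \<rho>C that by (simp add: ext_past)
  next
    case False
    then have "norm (ext u s) \<le> K * exp (A s) / exp (\<omega> * s)"
      using ext_growth[OF that(1), of s] by (simp add: field_simps)
    also have "\<dots> = K * exp (A s - \<omega> * s)" by (simp add: exp_diff)
    also have "\<dots> \<le> C" using small[of s] False by (simp add: K_def A_def)
    finally show ?thesis .
  qed
  have ext_cont: "continuous_on {-\<tau>..} (ext u)" if u: "u \<in> X" for u
  proof -
    have "continuous_on ({-\<tau>..0} \<union> {0..}) (\<lambda>s. if s \<le> 0 then \<Phi> s else w s *\<^sub>R apply_bcontfun u s)"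
      by (rule continuous_on_cases)
         (use u in \<open>auto intro!: \<Phi> continuous_intros w_cont simp: X_iff w_zero\<close>)
    moreover have "{-\<tau>..0} \<union> {0..} = {-\<tau>..}" using tau by auto
    ultimately show ?thesis by (simp add: ext_def[abs_def])
  qed
  have ext_cont': "continuous_on {-\<tau>..T} (ext u)" if u: "u \<in> X" for u T
    by (rule continuous_on_subset[OF ext_cont[OF u]]) auto
  define I where "I u t = (SOME J. duhamel (forcing (ext u)) t J)" for u t
  have I: "duhamel (forcing (ext u)) t (I u t)" if "u \<in> X" "0 \<le> t" for u t
    unfolding I_def by (rule someI_ex) (intro duhamel_forcing_exists ext_cont' that)
  have I_cont: "continuous_on {0..} (I u)" if "u \<in> X" for u
    by (intro continuous_on_Ici_from_Icc duhamel_forcing_continuous[OF ext_cont'[OF that]] I that) auto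
  define G where "G u t = (1 / w t) *\<^sub>R (S t (\<Phi> 0) + I u t)" for u t
  \<comment> \<open>the Duhamel formula in terms of \<open>u = U / w\<close>, extended to negative times by its value at \<open>0\<close>\<close>
  define \<Gamma> where "\<Gamma> u = Bcontfun (\<lambda>t. G u (max 0 t))" for u
  \<comment> \<open>invariance of \<open>X\<close>: compare with the zero solution and use the exponent \<open>1\<close>\<close>
  have G_bound: "norm (G u t) \<le> K * exp (- A t)" if u: "u \<in> X" and t: "0 \<le> t" for u t
  proof -
    have "exp (\<omega> * t) * norm (I u t - 0) \<le> \<rho> * history_mass (L C)
        + integral {0..t} (\<lambda>s. rate (L C) s * (exp (\<omega> * s) * norm (ext u s - 0)))"
    proof (rule duhamel_difference_le[OF t C ext_cont'[OF u] _ _ _ I[OF u t] duhamel_forcing_zero[OF t]])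
      show "exp (\<omega> * s) * norm (ext u s - 0) \<le> \<rho>" if s: "s \<in> {-\<tau>..0}" for s
      proof -
        have "exp (\<omega> * s) \<le> 1" using s \<omega>_nonneg by (simp add: mult_nonneg_nonpos)
        then have "exp (\<omega> * s) * norm (\<Phi> s) \<le> 1 * \<rho>"
          using \<Phi>(2)[OF s] by (intro mult_mono) auto
        then show ?thesis using s by (simp add: ext_past)
      qed
    qed (use C ext_bound[OF u] in auto)
    also have "integral {0..t} (\<lambda>s. rate (L C) s * (exp (\<omega> * s) * norm (ext u s - 0)))
        \<le> K * (exp (1 * integral {0..t} (rate (L C))) - 1) / 1"
    proof (rule integral_exp_majorant_le)
      show "continuous_on {0..t} (\<lambda>s. exp (\<omega> * s) * norm (ext u s - 0))"
        by (intro continuous_intros continuous_on_subset[OF ext_cont[OF u]]) (use tau in auto)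
      show "exp (\<omega> * s) * norm (ext u s - 0) \<le> K * exp (1 * integral {0..s} (rate (L C)))" if "s \<in> {0..t}" for s
        using ext_growth[OF u, of s] that by (simp add: A_def growth_def)
    qed (use K0 t L0 in \<open>auto intro: rate_int rate_nonneg\<close>)
    finally have Ib: "exp (\<omega> * t) * norm (I u t) \<le> \<rho> * history_mass (L C) + K * (exp (A t) - 1)"
      by (simp add: A_def growth_def)
    have "exp (\<omega> * t) * norm (S t (\<Phi> 0)) \<le> exp (\<omega> * t) * (M * exp (- \<omega> * t) * norm (\<Phi> 0))"
      by (intro mult_left_mono decay t) auto
    also have "\<dots> = M * norm (\<Phi> 0)" by (simp add: exp_minus)
    also have "\<dots> \<le> M * \<rho>" using \<Phi>(2)[of 0] tau M_nonneg by (intro mult_left_mono) auto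
    finally have "exp (\<omega> * t) * norm (S t (\<Phi> 0)) \<le> M * \<rho>" .
    moreover have "exp (\<omega> * t) * norm (S t (\<Phi> 0) + I u t)
        \<le> exp (\<omega> * t) * norm (S t (\<Phi> 0)) + exp (\<omega> * t) * norm (I u t)"
      using norm_triangle_ineq[of "S t (\<Phi> 0)" "I u t"] by (simp flip: distrib_left)
    ultimately have sum: "exp (\<omega> * t) * norm (S t (\<Phi> 0) + I u t) \<le> K * exp (A t)"
      using Ib by (simp add: K_def algebra_simps)
    have "norm (G u t) = exp (- 2 * A t) * (exp (\<omega> * t) * norm (S t (\<Phi> 0) + I u t))"
      unfolding G_def w_inverse by (simp add: abs_mult)
    also have "\<dots> \<le> exp (- 2 * A t) * (K * exp (A t))"
      by (intro mult_left_mono sum) auto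
    also have "\<dots> = K * exp (- A t)" by (simp flip: exp_add)
    finally show ?thesis .
  qed
  have G_mem: "(\<lambda>t. G u (max 0 t)) \<in> bcontfun" if u: "u \<in> X" for u
  proof (rule bcontfun_normI)
    have "continuous_on {0..} (G u)"
      unfolding G_def using w_pos 
      by (intro continuous_intros w_cont orbit_continuous I_cont u) (auto simp: less_imp_neq[symmetric])
    then show "continuous_on UNIV (\<lambda>t. G u (max 0 t))"
      by (rule continuous_on_compose2) (auto intro!: continuous_intros)
    show "norm (G u (max 0 t)) \<le> K" for t
    proof -
      have "K * exp (- A (max 0 t)) \<le> K * 1"
        using A_nonneg K0 by (intro mult_left_mono) auto
      then show ?thesis using G_bound[OF u, of "max 0 t"] by simp
    qed
  qed
  have \<Gamma>_apply: "apply_bcontfun (\<Gamma> u) t = G u (max 0 t)" if "u \<in> X" for u t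
    unfolding \<Gamma>_def by (simp add: Bcontfun_inverse[OF G_mem[OF that]])
  have I_zero: "I u 0 = 0" if u: "u \<in> X" for u
  proof -
    have int: "integrable (lebesgue_on {0..0}) (\<lambda>s. norm (S (0 - s) (forcing (ext u) s)))"
      by (subst absolutely_integrable_on_iff_lebesgue_on[symmetric]) (rule absolutely_integrable_continuous_real, simp)
    have "norm (I u 0) \<le> (LINT s|lebesgue_on {0..0}. norm (S (0 - s) (forcing (ext u) s)))"
      by (rule norm_bochner_integral_le[OF complete_measure_lebesgue_on _ int])
         (use I[OF u, of 0] in \<open>auto simp: duhamel_def\<close>)
    also have "\<dots> = 0" by (subst lebesgue_integral_eq_integral[OF int]) auto
    finally show ?thesis by simp
  qed
  have self: "\<Gamma> ` X \<subseteq> X"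
    using G_bound by (auto simp: X_iff \<Gamma>_apply G_def[of _ 0] w_zero I_zero S_zero)
  \<comment> \<open>equal histories cancel, and the exponent \<open>2\<close> gives the factor \<open>1/2\<close>\<close>
  have contr: "dist (\<Gamma> u) (\<Gamma> v) \<le> 1/2 * dist u v" if u: "u \<in> X" and v: "v \<in> X" for u v
  proof (rule dist_bound)
    fix x :: real
    define t where "t = max 0 x"
    have t: "0 \<le> t" by (simp add: t_def)
    let ?d = "dist u v"
    let ?\<phi> = "\<lambda>s. exp (\<omega> * s) * norm (ext u s - ext v s)"
    have \<phi>_le: "?\<phi> s \<le> ?d * exp (2 * A s)" if s: "0 \<le> s" for s
    proof -
      have "?\<phi> s = exp (\<omega> * s) * (w s * norm (apply_bcontfun u s - apply_bcontfun v s))"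
        using w_pos[of s] by (simp add: ext_now[OF u s] ext_now[OF v s] flip: scaleR_diff_right)
      also have "\<dots> \<le> exp (\<omega> * s) * (w s * ?d)"
        using dist_bounded[of u s v] w_pos[of s] by (intro mult_left_mono) (auto simp: dist_norm)
      also have "\<dots> = ?d * exp (2 * A s)" by (simp add: w_def exp_diff)
      finally show ?thesis .
    qed
    have "exp (\<omega> * t) * norm (I u t - I v t) \<le> 0 * history_mass (L C)
        + integral {0..t} (\<lambda>s. rate (L C) s * ?\<phi> s)"
      by (rule duhamel_difference_le[OF t C ext_cont'[OF u] _ ext_cont'[OF v] _ I[OF u t] I[OF v t]])
         (use ext_bound u v in \<open>auto simp: ext_past\<close>)
    also have "integral {0..t} (\<lambda>s. rate (L C) s * ?\<phi> s) \<le> ?d * (exp (2 * integral {0..t} (rate (L C))) - 1) / 2"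
    proof (rule integral_exp_majorant_le)
      show "continuous_on {0..t} ?\<phi>"
        by (intro continuous_intros continuous_on_subset[OF ext_cont[OF u]] continuous_on_subset[OF ext_cont[OF v]])
           (use tau in auto)
    qed (use t L0 \<phi>_le in \<open>auto intro: rate_int rate_nonneg simp: A_def growth_def\<close>)
    finally have *: "exp (\<omega> * t) * norm (I u t - I v t) \<le> ?d * (exp (2 * A t) - 1) / 2"
      by (simp add: A_def growth_def)
    also have "\<dots> \<le> ?d / 2 * exp (2 * A t)" by (simp add: algebra_simps)
    finally have Id: "exp (\<omega> * t) * norm (I u t - I v t) \<le> ?d / 2 * exp (2 * A t)" .
    have "dist (apply_bcontfun (\<Gamma> u) x) (apply_bcontfun (\<Gamma> v) x) = norm (G u t - G v t)"
      by (simp add: \<Gamma>_apply u v dist_norm t_def)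
    also have "G u t - G v t = (1 / w t) *\<^sub>R (I u t - I v t)"
      by (simp add: G_def algebra_simps)
    also have "norm \<dots> = exp (- 2 * A t) * (exp (\<omega> * t) * norm (I u t - I v t))"
      unfolding w_inverse by (simp add: abs_mult)
    also have "\<dots> \<le> exp (- 2 * A t) * (?d / 2 * exp (2 * A t))"
      by (intro mult_left_mono Id) auto
    also have "\<dots> = 1/2 * ?d" by (simp add: exp_minus)
    finally show "dist (apply_bcontfun (\<Gamma> u) x) (apply_bcontfun (\<Gamma> v) x) \<le> 1/2 * ?d" .
  qed
  have "complete X"
    unfolding X_def complete_eq_closed by (intro closed_PiC) auto
  \<comment> \<open>the initial value, damped by \<open>exp (- A)\<close> to respect the bound in \<open>X\<close>\<close>
  moreover have "X \<noteq> {}"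
  proof -
    have mem: "(\<lambda>t. exp (- A (max 0 t)) *\<^sub>R \<Phi> 0) \<in> bcontfun"
    proof (rule bcontfun_normI)
      show "continuous_on UNIV (\<lambda>t. exp (- A (max 0 t)) *\<^sub>R \<Phi> 0)"
        by (intro continuous_intros continuous_on_compose2[OF A_cont]) auto
      show "norm (exp (- A (max 0 t)) *\<^sub>R \<Phi> 0) \<le> norm (\<Phi> 0)" for t
        using A_nonneg[of "max 0 t"] by (simp add: mult_left_le_one_le)
    qed
    have "Bcontfun (\<lambda>t. exp (- A (max 0 t)) *\<^sub>R \<Phi> 0) \<in> X"
      unfolding X_iff Bcontfun_inverse[OF mem] using \<Phi>0_K by (auto simp: A_zero mult.commute)
    then show ?thesis by blast
  qed
  ultimately obtain u where u: "u \<in> X" "\<Gamma> u = u"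
    using Banach_fix[of X "1/2" \<Gamma>] self contr by auto
  have "ext u t = S t (\<Phi> 0) + I u t" if t: "0 \<le> t" for t
    using \<Gamma>_apply[OF u(1), of t] t w_pos[of t] by (simp add: u(2) ext_now[OF u(1) t] G_def max_def)
  then have "mild_solution \<tau> S \<alpha> B F \<Phi> (ext u)"
    unfolding mild_solution_iff using ext_cont[OF u(1)] I[OF u(1)] by (auto simp: ext_past)
  moreover have "\<forall>t\<ge>0. norm (ext u t) \<le> C" using ext_bound[OF u(1)] tau by auto
  ultimately show ?thesis by blast
qed

text \<open>The first term is the quantity that the smallness condition on \<open>\<alpha>\<close> controls.\<close>

lemma growth_eq:
  assumes "0 \<le> t"
  shows "growth l t = M * b * exp (\<omega> * \<tau>) * (LINT s|lebesgue_on {0..t}. \<bar>\<alpha> (s + \<tau>)\<bar>)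
    + M * l * (1 + exp (\<omega> * \<tau>)) * t"
proof -
  have "(\<lambda>s. \<bar>\<alpha> s\<bar>) integrable_on {\<tau>..\<tau> + t}"
    using tau by (intro set_lebesgue_integral_eq_integral(1) set_integrable_abs \<alpha>_abs_int) auto
  then have int: "(\<lambda>s. \<bar>\<alpha> (s + \<tau>)\<bar>) integrable_on {0..t}"
    using integrable_on_shift_Icc_real[of "\<lambda>s. \<bar>\<alpha> s\<bar>" \<tau> 0 t] by (simp add: add.commute comp_def)
  then have "(\<lambda>s. \<bar>\<alpha> (s + \<tau>)\<bar>) absolutely_integrable_on {0..t}"
    by (intro nonnegative_absolutely_integrable_1) auto
  then have LINT: "(LINT s|lebesgue_on {0..t}. \<bar>\<alpha> (s + \<tau>)\<bar>) = integral {0..t} (\<lambda>s. \<bar>\<alpha> (s + \<tau>)\<bar>)"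
    unfolding absolutely_integrable_on_iff_lebesgue_on by (intro lebesgue_integral_eq_integral) auto
  have "growth l t = integral {0..t} (\<lambda>s. M * b * exp (\<omega> * \<tau>) * \<bar>\<alpha> (s + \<tau>)\<bar> + M * l * (1 + exp (\<omega> * \<tau>)))"
    unfolding growth_def rate_def[abs_def] delay_weight_def by (simp add: algebra_simps)
  also have "\<dots> = M * b * exp (\<omega> * \<tau>) * integral {0..t} (\<lambda>s. \<bar>\<alpha> (s + \<tau>)\<bar>) + M * l * (1 + exp (\<omega> * \<tau>)) * t"
    using assms by (subst integral_add) (auto intro!: integrable_on_mult_right int simp: mult_ac)
  finally show ?thesis by (simp add: LINT)
qed

text \<open>The two conditions add up to \<open>growth (L C) t \<le> \<gamma> + \<omega> t\<close>, so the invariant bound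
  \<open>K exp (growth (L C) t - \<omega> t)\<close> stays below \<open>K exp \<gamma>\<close>, and \<open>K\<close> is proportional to the
  size of the history.\<close>

theorem small_histories_global:
  assumes M: "0 < M" and C: "0 < C" and LC: "M * L C * (1 + exp (\<omega> * \<tau>)) \<le> \<omega> - \<omega>'"
    and \<gamma>: "0 \<le> \<gamma>"
    and small: "\<And>t. 0 < t \<Longrightarrow>
      M * b * exp (\<omega> * \<tau>) * (LINT s|lebesgue_on {0..t}. \<bar>\<alpha> (s + \<tau>)\<bar>) \<le> \<gamma> + \<omega>' * t"
  shows "\<exists>\<rho>>0. \<forall>\<Phi>. continuous_on {-\<tau>..0} \<Phi> \<longrightarrow> (\<forall>s\<in>{-\<tau>..0}. norm (\<Phi> s) \<le> \<rho>) \<longrightarrow>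
    (\<exists>U. mild_solution \<tau> S \<alpha> B F \<Phi> U \<and> (\<forall>t\<ge>0. norm (U t) \<le> C))"
proof -
  have L0: "0 \<le> L C" by (rule L_nonneg[OF C])
  have g: "growth (L C) t - \<omega> * t \<le> \<gamma>" if "0 \<le> t" for t
  proof (cases "t = 0")
    case True
    then show ?thesis by (simp add: growth_zero \<gamma>)
  next
    case False
    then have "M * L C * (1 + exp (\<omega> * \<tau>)) * t \<le> (\<omega> - \<omega>') * t"
      using that by (intro mult_right_mono LC) auto
    then show ?thesis using growth_eq[OF that, of "L C"] small[of t] False that by (simp add: algebra_simps)
  qed
  define K where "K = M + history_mass (L C)"
  have "0 \<le> history_mass (L C)"
    unfolding history_mass_def
    by (intro Henstock_Kurzweil_Integration.integral_nonneg delay_weight_int delay_weight_nonneg L0) auto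
  then have K: "0 < K" using M by (simp add: K_def)
  \<comment> \<open>the first bound keeps the history, the second one the solution, in the ball of radius \<open>C\<close>\<close>
  define \<rho> where "\<rho> = min C (C * exp (- \<gamma>) / K)"
  have \<rho>: "0 < \<rho>" using C K by (simp add: \<rho>_def)
  have "\<rho> * K * exp (growth (L C) t - \<omega> * t) \<le> C" if "0 \<le> t" for t
  proof -
    have "\<rho> * K \<le> C * exp (- \<gamma>)"
      using K mult_right_mono[of \<rho> "C * exp (- \<gamma>) / K" K] by (simp add: \<rho>_def)
    then have "\<rho> * K * exp (growth (L C) t - \<omega> * t) \<le> (C * exp (- \<gamma>)) * exp \<gamma>"
      using g[OF that] C by - (rule mult_mono, auto)
    also have "\<dots> = C" by (simp add: exp_minus)
    finally show ?thesis .
  qed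
  then show ?thesis
    using mild_solution_exists_bounded[of _ \<rho> C] C \<rho> unfolding K_def[symmetric] 
    by (intro exI[of _ \<rho>]) (auto simp: \<rho>_def)
qed

end

section \<open>The phase space of the memory problem\<close>

lemma adjoint_bounded_linear:
  fixes B Bs :: "'h::real_inner \<Rightarrow> 'h"
  assumes B: "bounded_linear B" and adj: "\<And>x y. B x \<bullet> y = x \<bullet> Bs y"
  shows "bounded_linear Bs"
proof -
  obtain K where K: "0 < K" "\<And>x. norm (B x) \<le> norm x * K"
    using bounded_linear.pos_bounded[OF B] by blast
  show ?thesis
  proof (rule bounded_linear_intro[of _ K])
    show "Bs (x + y) = Bs x + Bs y" for x y
      by (subst vector_eq_ldot[symmetric]) (simp add: adj[symmetric] inner_add_right)
    show "Bs (r *\<^sub>R x) = r *\<^sub>R Bs x" for r x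
      by (subst vector_eq_ldot[symmetric]) (simp add: adj[symmetric])
    show "norm (Bs y) \<le> norm y * K" for y
    proof -
      have "norm (Bs y) * norm (Bs y) = B (Bs y) \<bullet> y"
        by (simp add: adj flip: power2_eq_square power2_norm_eq_inner)
      also have "\<dots> \<le> norm (B (Bs y)) * norm y" by (rule norm_cauchy_schwarz)
      also have "\<dots> \<le> norm (Bs y) * (norm y * K)"
        using mult_right_mono[OF K(2)[of "Bs y"], of "norm y"] by (simp add: mult_ac)
      finally show ?thesis
        using K(1) by (cases "norm (Bs y) = 0") auto
    qed
  qed
qed

lemma op_sqrt_zero:
  assumes "op_sqrt DA A DR R"
  shows "0 \<in> DR" "R 0 = 0"
proof -
  have D: "subspace DR" and sc: "\<And>c x. x \<in> DR \<Longrightarrow> R (c *\<^sub>R x) = c *\<^sub>R R x"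
    using assms unfolding op_sqrt_def self_adjoint_op_def by auto
  show "0 \<in> DR" using D by (rule subspace_0)
  then show "R 0 = 0" using sc[of 0 0] by simp
qed

context
  fixes DA DR :: "'h::real_inner set" and A R :: "'h \<Rightarrow> 'h" and k :: "real \<Rightarrow> real"
    and E :: "'h \<times> 'h \<times> (real \<Rightarrow> 'h) \<Rightarrow> 'x::{real_inner, complete_space}"
  assumes R: "op_sqrt DA A DR R" and E: "phase_space_map DR R k E"
begin

text \<open>The elements \<open>E (0, v, 0)\<close> form an isometric copy of the space of velocities,
  and pairing with them reads off the velocity of any element. Linearity and
  boundedness of \<open>vel_part\<close> follow because it is the adjoint of this embedding,
  although it is defined through a choice of representatives.\<close>

lemma kinetic_rep: "(0, v, \<lambda>s. 0) \<in> phase_reps DR R k"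
  unfolding phase_reps_def L2_memory_def
  by (auto simp: op_sqrt_zero[OF R] intro: strongly_measurable_simple_function)

lemma inner_kinetic:
  assumes "Y \<in> phase_reps DR R k"
  shows "E Y \<bullet> E (0, v, \<lambda>s. 0) = fst (snd Y) \<bullet> v"
proof -
  have "E Y \<bullet> E (0, v, \<lambda>s. 0) = phase_inner R k Y (0, v, \<lambda>s. 0)"
    using E assms kinetic_rep unfolding phase_space_map_def by blast
  also have "\<dots> = fst (snd Y) \<bullet> v"
    by (cases Y) (simp add: op_sqrt_zero[OF R])
  finally show ?thesis .
qed

lemma rep_of: "inv_into (phase_reps DR R k) E X \<in> phase_reps DR R k"
  "E (inv_into (phase_reps DR R k) E X) = X"
proof -
  have "X \<in> E ` phase_reps DR R k" using E unfolding phase_space_map_def by simp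
  then show "inv_into (phase_reps DR R k) E X \<in> phase_reps DR R k" "E (inv_into (phase_reps DR R k) E X) = X"
    by (auto intro: inv_into_into f_inv_into_f)
qed

lemma kinetic_bounded_linear: "bounded_linear (\<lambda>v. E (0, v, \<lambda>s. 0))"
proof (rule bounded_linear_intro[of _ 1])
  show "E (0, v + v', \<lambda>s. 0) = E (0, v, \<lambda>s. 0) + E (0, v', \<lambda>s. 0)" for v v'
  proof -
    have "E (0 + 0, v + v', \<lambda>s. 0 + 0) = E (0, v, \<lambda>s. 0) + E (0, v', \<lambda>s. 0)"
      using E kinetic_rep unfolding phase_space_map_def by blast
    then show ?thesis by simp
  qed
  show "E (0, c *\<^sub>R v, \<lambda>s. 0) = c *\<^sub>R E (0, v, \<lambda>s. 0)" for c v
  proof -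
    have "E (c *\<^sub>R 0, c *\<^sub>R v, \<lambda>s. c *\<^sub>R 0) = c *\<^sub>R E (0, v, \<lambda>s. 0)"
      using E kinetic_rep unfolding phase_space_map_def by blast
    then show ?thesis by simp
  qed
  show "norm (E (0, v, \<lambda>s. 0)) \<le> norm v * 1" for v
    using inner_kinetic[OF kinetic_rep, of v v] by (simp add: norm_eq_sqrt_inner)
qed

lemma vel_part_inner: "vel_part DR R k E X \<bullet> v = X \<bullet> E (0, v, \<lambda>s. 0)"
  using inner_kinetic[OF rep_of(1), of X v] by (simp add: rep_of(2) vel_part_def)

lemma vel_part_bounded_linear: "bounded_linear (vel_part DR R k E)"
proof (rule bounded_linear_intro[of _ 1])
  let ?vel = "vel_part DR R k E"
  show "?vel (X + Y) = ?vel X + ?vel Y" for X Y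
    by (subst vector_eq_rdot[symmetric]) (simp add: vel_part_inner inner_add_left)
  show "?vel (c *\<^sub>R X) = c *\<^sub>R ?vel X" for c X
    by (subst vector_eq_rdot[symmetric]) (simp add: vel_part_inner)
  show "norm (?vel X) \<le> norm X * 1" for X
  proof -
    have "norm (?vel X) * norm (?vel X) = X \<bullet> E (0, ?vel X, \<lambda>s. 0)"
      by (simp flip: power2_eq_square power2_norm_eq_inner vel_part_inner)
    also have "\<dots> \<le> norm X * norm (E (0, ?vel X, \<lambda>s. 0))" by (rule norm_cauchy_schwarz)
    also have "norm (E (0, ?vel X, \<lambda>s. 0)) = norm (?vel X)"
      using inner_kinetic[OF kinetic_rep, of "?vel X" "?vel X"] by (simp add: norm_eq_sqrt_inner)
    finally show ?thesis by (cases "norm (?vel X) = 0") auto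
  qed
qed

lemma delay_op_bounded_linear:
  assumes B: "bounded_linear B" and adj: "\<And>x y. B x \<bullet> y = x \<bullet> Bs y"
  shows "bounded_linear (delay_op DR R k E B Bs)"
proof -
  have "bounded_linear (\<lambda>X. E (0, - B (Bs (vel_part DR R k E X)), \<lambda>s. 0))"
    by (intro bounded_linear_compose[OF kinetic_bounded_linear] bounded_linear_minus
        bounded_linear_compose[OF B] bounded_linear_compose[OF adjoint_bounded_linear[OF B adj]]
        vel_part_bounded_linear)
  then show ?thesis by (simp add: delay_op_def[abs_def])
qed

text \<open>A representative of the zero element has phase norm zero. All three terms of the
  norm are nonnegative and the first one has a positive coefficient, so the first one
  vanishes.\<close>

lemma sqrt_pos_part_zero:
  assumes k: "\<And>t. 0 \<le> t \<Longrightarrow> 0 \<le> k t" and mass: "k_mass k < 1"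
  shows "pos_part DR R k E 0 \<in> DR" "R (pos_part DR R k E 0) = 0"
proof -
  obtain u v w where Y: "inv_into (phase_reps DR R k) E 0 = (u, v, w)" by (metis prod_cases3)
  have mem: "(u, v, w) \<in> phase_reps DR R k" and E0: "E (u, v, w) = 0"
    using rep_of[of 0] by (simp_all add: Y)
  then show "pos_part DR R k E 0 \<in> DR" unfolding pos_part_def Y by (simp add: phase_reps_def)
  have "phase_inner R k (u, v, w) (u, v, w) = E (u, v, w) \<bullet> E (u, v, w)"
    using E mem unfolding phase_space_map_def by (metis (no_types, lifting))
  then have "(1 - k_mass k) * (R u \<bullet> R u) + v \<bullet> v + (LINT s|lebesgue_on {0<..}. k s * (R (w s) \<bullet> R (w s))) = 0"
    by (simp add: E0)
  moreover have "0 \<le> (LINT s|lebesgue_on {0<..}. k s * (R (w s) \<bullet> R (w s)))"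
    by (rule Bochner_Integration.integral_nonneg) (simp add: k)
  moreover have "0 \<le> (1 - k_mass k) * (R u \<bullet> R u)" using mass by simp
  ultimately have "(1 - k_mass k) * (R u \<bullet> R u) = 0" using inner_ge_zero[of v] by linarith
  then show "R (pos_part DR R k E 0) = 0" using mass by (simp add: pos_part_def Y)
qed

text \<open>The chosen representative of the zero element has a first component \<open>u\<close> with
  \<open>R u = 0\<close>, and the Lipschitz estimate compares \<open>G1 u\<close> and \<open>G2 u\<close> with the values at
  \<open>0\<close>.\<close>

lemma nonlin_map_zero:
  assumes k: "\<And>t. 0 \<le> t \<Longrightarrow> 0 \<le> k t" and mass: "k_mass k < 1"
    and lip: "\<And>u v. u \<in> DR \<Longrightarrow> v \<in> DR \<Longrightarrow> norm (R u) \<le> 1 \<Longrightarrow> norm (R v) \<le> 1 \<Longrightarrow> norm (G1 u - G1 v) \<le> l * norm (R (u - v))"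
     "\<And>u v. u \<in> DR \<Longrightarrow> v \<in> DR \<Longrightarrow> norm (R u) \<le> 1 \<Longrightarrow> norm (R v) \<le> 1 \<Longrightarrow> norm (G2 u - G2 v) \<le> l * norm (R (u - v))"
    and zero: "G1 0 = 0" "G2 0 = 0"
  shows "nonlin_map DR R k E G1 G2 0 0 = 0"
proof -
  let ?u = "pos_part DR R k E 0"
  have "G1 ?u = 0" "G2 ?u = 0"
    using lip(1)[of ?u 0] lip(2)[of ?u 0] sqrt_pos_part_zero[OF k mass] op_sqrt_zero[OF R] zero by auto
  then show ?thesis
    using linear_0[OF bounded_linear.linear[OF kinetic_bounded_linear]] by (simp add: nonlin_map_def)
qed

end

section \<open>Global solutions of the wave equation with memory and delay\<close>

text \<open>It remains to check that the phase space formulation is an instance of the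
  abstract delay equation, and to choose \<open>C\<close>: since \<open>L r\<close> tends to \<open>0\<close>, some positive
  \<open>C\<close> makes \<open>L C\<close> smaller than the threshold. A history with supremum below \<open>\<rho>\<close> is
  small in the sense of \<open>small_histories_global\<close>.\<close>

theorem theorem3p6:
  fixes DA DR :: "'h::{real_inner, complete_space} set"
    and A R B Bs G1 G2 :: "'h \<Rightarrow> 'h"
    and \<psi>1 \<psi>2 :: "'h \<Rightarrow> real"
    and k k' \<alpha> L :: "real \<Rightarrow> real"
    and \<tau> \<sigma> \<zeta> M \<omega> \<gamma> \<omega>' b :: real
    and E :: "'h \<times> 'h \<times> (real \<Rightarrow> 'h) \<Rightarrow> 'x::{real_inner, complete_space}"
    and S :: "real \<Rightarrow> 'x \<Rightarrow> 'x"
    and Bh :: "'x \<Rightarrow> 'x"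
    and Fh :: "'x \<Rightarrow> 'x \<Rightarrow> 'x"
  assumes A: "self_adjoint_op DA A" "positive_op DA A"
    and R: "op_sqrt DA A DR R"
    and B: "bounded_linear B" "\<And>x y. B x \<bullet> y = x \<bullet> Bs y"
    and tau: "\<tau> > 0"
    and alpha_loc: "\<And>T. T \<ge> 0 \<Longrightarrow> integrable (lebesgue_on {0..T}) \<alpha>"
    and alpha_neg: "\<And>t. t < 0 \<Longrightarrow> \<alpha> t = 0"
    and alpha_sigma: "\<sigma> > 0" "\<And>t. t \<ge> 0 \<Longrightarrow> (LINT s|lebesgue_on {t-\<tau>..t}. \<bar>\<alpha> s\<bar>) \<le> \<sigma>"
    and k_nonneg: "\<And>t. t \<ge> 0 \<Longrightarrow> k t \<ge> 0"
    and k_C1: "\<And>t. t \<ge> 0 \<Longrightarrow> (k has_real_derivative k' t) (at t within {0..})"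
              "continuous_on {0..} k'"
    and k_L1: "integrable (lebesgue_on {0<..}) k"
    and k_0: "k 0 > 0"
    and k_mass: "k_mass k < 1"
    and k_decay: "\<zeta> > 0" "\<And>t. t \<ge> 0 \<Longrightarrow> k' t \<le> - \<zeta> * k t"
    and grad: "riesz_gradient DR \<psi>1 G1" "riesz_gradient DR \<psi>2 G2"
    and L_pos: "\<And>r. r > 0 \<Longrightarrow> L r > 0"
    and L_lim: "(L \<longlongrightarrow> 0) (at_right 0)"
    and G1_lip: "\<And>r u v. r > 0 \<Longrightarrow> u \<in> DR \<Longrightarrow> v \<in> DR \<Longrightarrow> norm (R u) \<le> r \<Longrightarrow> norm (R v) \<le> r
                  \<Longrightarrow> norm (G1 u - G1 v) \<le> L r * norm (R (u - v))"
    and G2_lip: "\<And>r u v. r > 0 \<Longrightarrow> u \<in> DR \<Longrightarrow> v \<in> DR \<Longrightarrow> norm (R u) \<le> r \<Longrightarrow> norm (R v) \<le> r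
                  \<Longrightarrow> norm (G2 u - G2 v) \<le> L r * norm (R (u - v))"
    and psi_0: "\<psi>1 0 = 0" "\<psi>2 0 = 0" "G1 0 = 0" "G2 0 = 0"
    and psi1_growth: "\<exists>h1 :: real \<Rightarrow> real. strict_mono_on {0..} h1 \<and> continuous_on {0..} h1 \<and>
                  (\<forall>u\<in>DR. \<bar>G1 u \<bullet> u\<bar> \<le> h1 (norm (R u)) * (norm (R u))\<^sup>2)"
    and E: "phase_space_map DR R k E"
    and Bh: "Bh = delay_op DR R k E B Bs"
    and Fh: "Fh = nonlin_map DR R k E G1 G2"
    and Fh_lip: "\<And>r X1 Y1 X2 Y2. r > 0 \<Longrightarrow> norm X1 \<le> r \<Longrightarrow> norm Y1 \<le> r \<Longrightarrow>
                  norm X2 \<le> r \<Longrightarrow> norm Y2 \<le> r \<Longrightarrow>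
                  norm (Fh X1 Y1 - Fh X2 Y2) \<le> L r * (norm (X1 - X2) + norm (Y1 - Y2))"
    and S: "C0_semigroup S" "generator_graph S = wave_op_graph DA A DR R k E"
    and S_decay: "M > 0" "\<omega> > 0" "\<And>t. t \<ge> 0 \<Longrightarrow> onorm (S t) \<le> M * exp (- \<omega> * t)"
    and b: "b = onorm Bh"
    and gamma: "\<gamma> \<ge> 0"
    and omega': "0 \<le> \<omega>'" "\<omega>' < \<omega>"
    and smallness: "\<And>t. t > 0 \<Longrightarrow>
          M * b * exp (\<omega> * \<tau>) * (LINT s|lebesgue_on {0..t}. \<bar>\<alpha> (s + \<tau>)\<bar>) \<le> \<gamma> + \<omega>' * t"
  shows "\<exists>\<rho>>0. \<exists>C>0.
    L C < (\<omega> - \<omega>') / (M * (1 + exp (\<omega> * \<tau>))) \<and>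
    (\<forall>(f0 :: real \<Rightarrow> 'h) (g0 :: real \<Rightarrow> 'h) (\<eta>0 :: real \<Rightarrow> 'h) (\<Phi> :: real \<Rightarrow> 'x).
       (\<forall>s\<le>0. f0 s \<in> DR) \<longrightarrow>
       \<eta>0 = (\<lambda>s. f0 0 - f0 (- s)) \<longrightarrow>
       \<eta>0 \<in> L2_memory DR R k \<longrightarrow>
       \<Phi> = (\<lambda>s. E (f0 s, g0 s, \<eta>0)) \<longrightarrow>
       continuous_on {-\<tau>..0} \<Phi> \<longrightarrow>
       (norm (g0 0))\<^sup>2 + (1 - k_mass k) * (norm (R (f0 0)))\<^sup>2
         + (LINT s|lebesgue_on {-\<tau>..0}. (norm (G2 (f0 s)))\<^sup>2)
         + (LINT s|lebesgue_on {0<..}. k s * (norm (R (\<eta>0 s)))\<^sup>2)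
         + (LINT s|lebesgue_on {-\<tau>..0}. \<bar>\<alpha> (s + \<tau>)\<bar> * (norm (Bs (g0 s)))\<^sup>2) < \<rho>\<^sup>2 \<longrightarrow>
       (SUP s\<in>{-\<tau>..0}. norm (\<Phi> s)) < \<rho> \<longrightarrow>
       (\<exists>U. mild_solution \<tau> S \<alpha> Bh Fh \<Phi> U \<and>
            (\<forall>t\<ge>0. norm (U t) \<le> C) \<and>
            (\<forall>V. mild_solution \<tau> S \<alpha> Bh Fh \<Phi> V \<longrightarrow> (\<forall>t\<ge>-\<tau>. V t = U t))))"
proof -
  have Bh_linear: "bounded_linear Bh"
    unfolding Bh by (rule delay_op_bounded_linear[OF R E B])
  interpret delay_evolution S \<alpha> Bh Fh L M \<omega> \<tau> b
  proof (rule delay_evolution.intro)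
    show "norm (S t x) \<le> M * exp (- \<omega> * t) * norm x" if t: "0 \<le> t" for t x
    proof -
      have "bounded_linear (S t)" using S(1) t unfolding C0_semigroup_def by blast
      then have "norm (S t x) \<le> onorm (S t) * norm x" by (rule onorm)
      also have "\<dots> \<le> M * exp (- \<omega> * t) * norm x"
        by (intro mult_right_mono S_decay(3) t) auto
      finally show ?thesis .
    qed
    show "norm (Bh X) \<le> b * norm X" for X unfolding b by (rule onorm[OF Bh_linear])
    show "0 \<le> b" unfolding b by (rule onorm_pos_le[OF Bh_linear])
    show "Fh 0 0 = 0"
      unfolding Fh by (rule nonlin_map_zero[OF R E, where l="L 1"])
        (use k_nonneg k_mass G1_lip[of 1] G2_lip[of 1] psi_0 in auto)
    show "norm (Fh X1 Y1 - Fh X2 Y2) \<le> L r * (norm (X1 - X2) + norm (Y1 - Y2))"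
      if "0 < r" "norm X1 \<le> r" "norm Y1 \<le> r" "norm X2 \<le> r" "norm Y2 \<le> r" for r X1 Y1 X2 Y2
      by (rule Fh_lip[OF that])
  qed (use tau S(1) S_decay alpha_loc Bh_linear L_pos in \<open>auto intro: less_imp_le\<close>)
  define \<theta> where "\<theta> = (\<omega> - \<omega>') / (M * (1 + exp (\<omega> * \<tau>)))"
  have den: "0 < M * (1 + exp (\<omega> * \<tau>))" using S_decay(1) by (simp add: add_pos_pos)
  then have "0 < \<theta>" using omega' by (simp add: \<theta>_def)
  then have "\<forall>\<^sub>F r in at_right 0. L r < \<theta>" by (rule order_tendstoD(2)[OF L_lim])
  then obtain d where "d > 0" "\<And>r. 0 < r \<Longrightarrow> r < d \<Longrightarrow> L r < \<theta>"
    unfolding eventually_at_right_field by auto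
  then obtain C where C: "0 < C" "L C < \<theta>" using field_lbound_gt_zero[of d d] by blast
  have "M * L C * (1 + exp (\<omega> * \<tau>)) \<le> \<omega> - \<omega>'"
    using C(2) den unfolding \<theta>_def by (simp add: pos_less_divide_eq mult_ac)
  from small_histories_global[OF S_decay(1) C(1) this gamma smallness]
  obtain \<rho> where \<rho>: "0 < \<rho>" and sol: "\<And>\<Phi>. continuous_on {-\<tau>..0} \<Phi> \<Longrightarrow> (\<forall>s\<in>{-\<tau>..0}. norm (\<Phi> s) \<le> \<rho>) \<Longrightarrow>
      \<exists>U. mild_solution \<tau> S \<alpha> Bh Fh \<Phi> U \<and> (\<forall>t\<ge>0. norm (U t) \<le> C)"
    by blast
  have "\<exists>U. mild_solution \<tau> S \<alpha> Bh Fh \<Phi> U \<and> (\<forall>t\<ge>0. norm (U t) \<le> C) \<and>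
      (\<forall>V. mild_solution \<tau> S \<alpha> Bh Fh \<Phi> V \<longrightarrow> (\<forall>t\<ge>-\<tau>. V t = U t))"
    if cont: "continuous_on {-\<tau>..0} \<Phi>" and SUP: "(SUP s\<in>{-\<tau>..0}. norm (\<Phi> s)) < \<rho>" for \<Phi>
  proof -
    have "bdd_above ((\<lambda>s. norm (\<Phi> s)) ` {-\<tau>..0})"
      by (intro bounded_imp_bdd_above compact_imp_bounded compact_continuous_image continuous_intros cont) auto
    then have "norm (\<Phi> s) \<le> \<rho>" if "s \<in> {-\<tau>..0}" for s
      using cSUP_upper[OF that, of "\<lambda>s. norm (\<Phi> s)"] SUP by simp
    then obtain U where "mild_solution \<tau> S \<alpha> Bh Fh \<Phi> U" "\<forall>t\<ge>0. norm (U t) \<le> C"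
      using sol[OF cont] by blast
    then show ?thesis using mild_solution_unique by blast
  qed
  then show ?thesis
    using \<rho> C unfolding \<theta>_def by (intro exI[of _ \<rho>] exI[of _ C]) auto
qed

end
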